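(* Let $W$ and $D$ satisfy the standing assumptions in the context, let $(\lambda_l)_{l\in\mathbb{N}}$ be the eigenvalues of the graphon integral operator $L[V](x)=\int_0^1W(x,y)V(y)\,dy$, and let $T$ be the operator $$T\rho(u,x)=-\frac{\beta}{2\pi}\int_0^1\!\!\int_0^{2\pi}W(x,y)D(u-v)\rho(v,y)\,dv\,dy,$$ restricted to functions even in $u$. Let $$\lambda_{m,l}=-\frac{\beta\lambda_l}{2\pi}\int_0^{2\pi}D(v)\cos(mv)\,dv,$$ and let $M\subset\mathbb{N}^2$ be the set of index pairs $(m,l)$ for which $\lambda_{m,l}$ is a simple eigenvalue of $T$. Then the system undergoes a bifurcation from the uniform state $\rho\equiv\frac1{2\pi}$ at the critical interaction strength $$\theta_c=\min_{(m,l)\in M}\left[-\frac{2\pi}{\beta\lambda_l}\left(\int_0^{2\pi}D(v)\cos(mv)\,dv\right)^{-1}\right].$$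
   Context: Standing assumptions: $W:[0,1]^2\to[0,1]$ is symmetric and measurable and satisfies $\int_0^1|W(x_1,y)-W(x_2,y)|\,dy\to0$ as $|x_1-x_2|\to0$; $D:[0,2\pi]\to\mathbb{R}$ is a Lipschitz continuous, even, $2\pi$-periodic function; $\beta$ is the inverse temperature and $\theta>0$ the interaction strength. $L$ is compact and self-adjoint and has a complete orthonormal basis of eigenfunctions $V_l$ with real eigenvalues $\lambda_l$. The system is the McKean-Vlasov equation for a probability density $\rho(t,u,x)$, $u\in[0,2\pi]$ (periodic), $x\in[0,1]$: $$\partial_t\rho=\theta\,\partial_u\Big(\rho\int_0^1\!\!\int_0^{2\pi}W(x,y)D'(u-v)\rho(t,v,y)\,dv\,dy\Big)+\beta^{-1}\partial_u^2\rho.$$ Its stationary states are the solutions of $\rho=f(\rho,\theta)$ with $$f(\rho,\theta)(u,x)=\frac1{Z}\exp\Big(-\beta\theta\int_0^1\!\!\int_0^{2\pi}W(x,y)D(u-v)\rho(v,y)\,dv\,dy\Big),$$ $Z$ being the normalisation (over $u$, for each $x$). The uniform state is a solution for every $\theta$; a bifurcation from it at $\theta_c$ means that $(\frac1{2\pi},\theta_c)$ is a bifurcation point of the equation $\rho-f(\rho,\theta)=0$. The operator $T$ is studied on the subspace of even probability densities, i.e. functions with $\rho(-u,x)=\rho(u,x)$. The functions $V_l(x)\cos(mu)$ are eigenfunctions of $T$ with eigenvalues $\lambda_{m,l}$. *)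

theory Defs
  imports "HOL-Analysis.Analysis"
begin

definition graphon :: "(real \<Rightarrow> real \<Rightarrow> real) \<Rightarrow> bool" where
  "graphon W \<longleftrightarrow>
     set_borel_measurable borel ({0..1} \<times> {0..1}) (\<lambda>(x, y). W x y) \<and>
     (\<forall>x\<in>{0..1}. \<forall>y\<in>{0..1}. W x y \<in> {0..1} \<and> W x y = W y x) \<and>
     (\<forall>\<epsilon>>0. \<exists>\<delta>>0. \<forall>x1\<in>{0..1}. \<forall>x2\<in>{0..1}. \<bar>x1 - x2\<bar> < \<delta> \<longrightarrow>
        (LBINT y:{0..1}. \<bar>W x1 y - W x2 y\<bar>) < \<epsilon>)"

(* D is given on one period and identified with its periodic extension to the real line. *)
definition interaction_potential :: "(real \<Rightarrow> real) \<Rightarrow> bool" where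
  "interaction_potential D \<longleftrightarrow>
     (\<exists>C. C-lipschitz_on {0..2 * pi} D) \<and>
     (\<forall>u. D (- u) = D u) \<and> (\<forall>u. D (u + 2 * pi) = D u)"

definition L2_unit :: "(real \<Rightarrow> real) set" where
  "L2_unit = {g. set_borel_measurable borel {0..1} g \<and> set_integrable lborel {0..1} (\<lambda>x. (g x)\<^sup>2)}"

definition graphon_op :: "(real \<Rightarrow> real \<Rightarrow> real) \<Rightarrow> (real \<Rightarrow> real) \<Rightarrow> real \<Rightarrow> real" where
  "graphon_op W g x = (LBINT y:{0..1}. W x y * g y)"

(* Complete orthonormal system of eigenfunctions in L^2([0,1]); indices start at 1. *)
definition graphon_eigenbasis ::
    "(real \<Rightarrow> real \<Rightarrow> real) \<Rightarrow> (nat \<Rightarrow> real \<Rightarrow> real) \<Rightarrow> (nat \<Rightarrow> real) \<Rightarrow> bool" where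
  "graphon_eigenbasis W V lam \<longleftrightarrow>
     (\<forall>l\<ge>1. V l \<in> L2_unit) \<and>
     (\<forall>k\<ge>1. \<forall>l\<ge>1. (LBINT x:{0..1}. V k x * V l x) = (if k = l then 1 else 0)) \<and>
     (\<forall>g\<in>L2_unit. (\<forall>l\<ge>1. (LBINT x:{0..1}. g x * V l x) = 0) \<longrightarrow>
        (AE x in lborel. x \<in> {0..1} \<longrightarrow> g x = 0)) \<and>
     (\<forall>l\<ge>1. AE x in lborel. x \<in> {0..1} \<longrightarrow> graphon_op W (V l) x = lam l * V l x)"

definition strip :: "(real \<times> real) set" where
  "strip = {0..2 * pi} \<times> {0..1}"

(* Representatives of the classes in L^2([0,2 pi] x [0,1]) that are 2 pi-periodic and even in the
   first variable; values at second arguments outside [0,1] are irrelevant. *)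
definition L2_even :: "(real \<Rightarrow> real \<Rightarrow> real) set" where
  "L2_even = {r. set_borel_measurable borel strip (\<lambda>(u, x). r u x) \<and>
                 set_integrable lborel strip (\<lambda>(u, x). (r u x)\<^sup>2) \<and>
                 (\<forall>u. \<forall>x\<in>{0..1}. r (- u) x = r u x \<and> r (u + 2 * pi) x = r u x)}"

definition L2_norm :: "(real \<Rightarrow> real \<Rightarrow> real) \<Rightarrow> real" where
  "L2_norm r = sqrt (LINT z:strip|lborel. (r (fst z) (snd z))\<^sup>2)"

definition even_densities :: "(real \<Rightarrow> real \<Rightarrow> real) set" where
  "even_densities = {r \<in> L2_even. \<forall>x\<in>{0..1}. (\<forall>u. 0 \<le> r u x) \<and> (LBINT u:{0..2 * pi}. r u x) = 1}"

definition mean_field ::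
    "(real \<Rightarrow> real \<Rightarrow> real) \<Rightarrow> (real \<Rightarrow> real) \<Rightarrow> (real \<Rightarrow> real \<Rightarrow> real) \<Rightarrow> real \<Rightarrow> real \<Rightarrow> real" where
  "mean_field W D r u x = (LBINT y:{0..1}. LBINT v:{0..2 * pi}. W x y * D (u - v) * r v y)"

definition stationary_map ::
    "(real \<Rightarrow> real \<Rightarrow> real) \<Rightarrow> (real \<Rightarrow> real) \<Rightarrow> real \<Rightarrow>
     (real \<Rightarrow> real \<Rightarrow> real) \<Rightarrow> real \<Rightarrow> real \<Rightarrow> real \<Rightarrow> real" where
  "stationary_map W D \<beta> r \<theta> u x =
     exp (- \<beta> * \<theta> * mean_field W D r u x) /
     (LBINT w:{0..2 * pi}. exp (- \<beta> * \<theta> * mean_field W D r w x))"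

(* Every L^2 x R neighbourhood of (1/(2 pi), \<theta>c) contains a solution (r, \<theta>) of
   r = f(r, \<theta>) with r different, as an L^2 class, from the uniform state. *)
definition bifurcation_from_uniform ::
    "(real \<Rightarrow> real \<Rightarrow> real) \<Rightarrow> (real \<Rightarrow> real) \<Rightarrow> real \<Rightarrow> real \<Rightarrow> bool" where
  "bifurcation_from_uniform W D \<beta> \<theta>c \<longleftrightarrow>
     (\<forall>\<epsilon>>0. \<exists>r\<in>even_densities. \<exists>\<theta>.
        \<bar>\<theta> - \<theta>c\<bar> < \<epsilon> \<and>
        0 < L2_norm (\<lambda>u x. r u x - 1 / (2 * pi)) \<and> L2_norm (\<lambda>u x. r u x - 1 / (2 * pi)) < \<epsilon> \<and>
        (\<forall>u. \<forall>x\<in>{0..1}. r u x = stationary_map W D \<beta> r \<theta> u x))"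

definition T_op ::
    "(real \<Rightarrow> real \<Rightarrow> real) \<Rightarrow> (real \<Rightarrow> real) \<Rightarrow> real \<Rightarrow>
     (real \<Rightarrow> real \<Rightarrow> real) \<Rightarrow> real \<Rightarrow> real \<Rightarrow> real" where
  "T_op W D \<beta> r u x = - (\<beta> / (2 * pi)) * mean_field W D r u x"

definition T_eigenspace ::
    "(real \<Rightarrow> real \<Rightarrow> real) \<Rightarrow> (real \<Rightarrow> real) \<Rightarrow> real \<Rightarrow> real \<Rightarrow> (real \<Rightarrow> real \<Rightarrow> real) set" where
  "T_eigenspace W D \<beta> \<mu> =
     {r \<in> L2_even. AE z in lborel. z \<in> strip \<longrightarrow>
        T_op W D \<beta> r (fst z) (snd z) = \<mu> * r (fst z) (snd z)}"

(* The eigenspace is one-dimensional modulo equality almost everywhere. T is self-adjoint, so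
   geometric and algebraic multiplicity agree. *)
definition simple_eigenvalue ::
    "(real \<Rightarrow> real \<Rightarrow> real) \<Rightarrow> (real \<Rightarrow> real) \<Rightarrow> real \<Rightarrow> real \<Rightarrow> bool" where
  "simple_eigenvalue W D \<beta> \<mu> \<longleftrightarrow>
     (\<exists>p\<in>T_eigenspace W D \<beta> \<mu>.
        \<not> (AE z in lborel. z \<in> strip \<longrightarrow> p (fst z) (snd z) = 0) \<and>
        (\<forall>q\<in>T_eigenspace W D \<beta> \<mu>. \<exists>c. AE z in lborel. z \<in> strip \<longrightarrow>
           q (fst z) (snd z) = c * p (fst z) (snd z)))"

definition cos_coeff :: "(real \<Rightarrow> real) \<Rightarrow> nat \<Rightarrow> real" where
  "cos_coeff D m = (LBINT v:{0..2 * pi}. D v * cos (real m * v))"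

definition mode_eigenvalue :: "(real \<Rightarrow> real) \<Rightarrow> real \<Rightarrow> (nat \<Rightarrow> real) \<Rightarrow> nat \<Rightarrow> nat \<Rightarrow> real" where
  "mode_eigenvalue D \<beta> lam m l = - (\<beta> * lam l / (2 * pi)) * cos_coeff D m"

(* The natural numbers start at 1 here. This matters for m: the modes with m = 0 are constant in u
   and do not affect f, which is normalised in u for each x. *)
definition simple_modes ::
    "(real \<Rightarrow> real \<Rightarrow> real) \<Rightarrow> (real \<Rightarrow> real) \<Rightarrow> real \<Rightarrow> (nat \<Rightarrow> real) \<Rightarrow> (nat \<times> nat) set" where
  "simple_modes W D \<beta> lam =
     {(m, l). 1 \<le> m \<and> 1 \<le> l \<and> simple_eigenvalue W D \<beta> (mode_eigenvalue D \<beta> lam m l)}"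

(* Pairs with eigenvalue 0 are left out, since the formula for the strength is undefined there. *)
definition critical_strengths ::
    "(real \<Rightarrow> real \<Rightarrow> real) \<Rightarrow> (real \<Rightarrow> real) \<Rightarrow> real \<Rightarrow> (nat \<Rightarrow> real) \<Rightarrow> real set" where
  "critical_strengths W D \<beta> lam =
     {- (2 * pi / (\<beta> * lam l)) * inverse (cos_coeff D m) | m l.
        (m, l) \<in> simple_modes W D \<beta> lam \<and> mode_eigenvalue D \<beta> lam m l \<noteq> 0}"

definition is_minimum :: "real \<Rightarrow> real set \<Rightarrow> bool" where
  "is_minimum c S \<longleftrightarrow> c \<in> S \<and> (\<forall>s\<in>S. c \<le> s)"

end

theory Submission
  imports Defs "HOL-Complex_Analysis.Great_Picard"
begin

text \<open>
  With \<open>g = 2 \<pi> \<theta> T r\<close> up to a function of \<open>x\<close>, a stationary state is \<open>r = e\<^sup>g / \<integral> e\<^sup>g du\<close>, and the equation for \<open>g\<close>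
  becomes \<open>N g = \<nu> g\<close> with \<open>\<nu> = 1 / \<theta>\<close> and \<open>N g = 2 \<pi> T (e\<^sup>g / \<integral> e\<^sup>g du)\<close>, whose derivative at \<open>0\<close> is \<open>T\<close>
  on functions of mean zero in \<open>u\<close>. At a simple eigenvalue \<open>\<mu> \<noteq> 0\<close> with eigenfunction \<open>\<phi>\<close> one looks for \<open>g = s (\<phi> + w)\<close>
  with \<open>w\<close> orthogonal to \<open>\<phi>\<close>. The component along \<open>\<phi>\<close> determines \<open>\<nu>\<close>, and applying the inverse
  of \<open>T - \<mu>\<close> on the orthogonal complement turns the rest into a fixed-point problem for \<open>w\<close>, contractive for small \<open>s\<close>.
  Everything takes place in the Banach space of bounded continuous functions, with the \<open>L\<^sup>2\<close> product as a
  second, weaker structure: \<open>T\<close> is bounded from the \<open>L\<^sup>2\<close> seminorm to the supremum norm and compact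
  by Arzela-Ascoli, so that neither the completeness of \<open>L\<^sup>2\<close> nor a spectral theorem is needed. Compactness
  also leaves only finitely many eigenvalues away from \<open>0\<close>, so the least positive strength is attained.
\<close>

section \<open>Compact symmetric operators and bifurcation from a simple eigenvalue\<close>

text \<open>Two structures are used together because neither suffices alone: exp is smooth as a
  superposition operator in the supremum norm but not on L^2, whereas symmetry and orthogonality are
  available only through the L^2 product. Because of the normalisation, the stationary map sees its
  exponent only up to a function of x, yet the original operator does act on functions of x, through
  the zeroth Fourier mode of D. The operator built here has that mode removed and is symmetrised in
  u, so that every function in its range is even and periodic, and so are the solutions found. Its
  eigenfunctions for nonzero eigenvalues are also eigenfunctions of the original operator, which is
  how simplicity of the latter carries over. Functions live on the whole plane, while the product
  integrates over the strip only. On this space the product is therefore only semidefinite; the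
  smoothing property compensates, because it makes T annihilate every vector of seminorm
  zero.\<close>

locale compact_symmetric_operator =
  fixes T :: "'a::banach \<Rightarrow> 'a" and B :: "'a \<Rightarrow> 'a \<Rightarrow> real" and C :: real
  assumes bounded_linear_T: "bounded_linear T"
    and bounded_bilinear_B: "bounded_bilinear B"
    and B_commute: "B x y = B y x"
    and B_nonneg: "0 \<le> B x x"
    and T_symmetric: "B (T x) y = B x (T y)"
    \<comment> \<open>Boundedness and compactness are required from the seminorm of \<open>B\<close>
      to the norm, which is stronger than the same properties within the norm. This is what upgrades
      seminorm estimates to norm estimates below.\<close>
    and T_smoothing: "(norm (T x))\<^sup>2 \<le> C * B x x"
    and T_compact: "(\<And>n::nat. B (f n) (f n) \<le> 1) \<Longrightarrow>
      \<exists>(r::nat \<Rightarrow> nat) l. strict_mono r \<and> (\<lambda>n. T (f (r n))) \<longlonglongrightarrow> l"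
begin

sublocale T: bounded_linear T
  by (rule bounded_linear_T)

sublocale B: bounded_bilinear B
  by (rule bounded_bilinear_B)

lemmas B_simps = B.add_left B.add_right B.diff_left B.diff_right B.scaleR_left B.scaleR_right
  B.minus_left B.minus_right B.zero_left B.zero_right

lemma B_diff_le: "B (x - y) (x - y) \<le> 2 * B x x + 2 * B y y"
  using B_nonneg[of "x + y"] by (simp add: B_simps B_commute[of y x])

lemma T_smoothing_abs: "(norm (T x))\<^sup>2 \<le> \<bar>C\<bar> * B x x"
  using T_smoothing[of x] mult_right_mono[OF abs_ge_self B_nonneg[of x], of C] by linarith

lemma T_eq_0: "B x x = 0 \<Longrightarrow> T x = 0"
  using T_smoothing[of x] by simp

text \<open>A vector of seminorm zero is annihilated by \<open>T\<close>, so it cannot be an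
  eigenvector for a nonzero eigenvalue. Eigenvectors can therefore be normalised with respect to
  \<open>B\<close>.\<close>

lemma eigenvector_pos:
  assumes "T x = \<mu> *\<^sub>R x" "\<mu> \<noteq> 0" "x \<noteq> 0"
  shows "0 < B x x"
  using assms T_eq_0[of x] B_nonneg[of x] by (metis less_eq_real_def scaleR_eq_0_iff)

lemma normalize_B:
  assumes "0 < B x x"
  shows "B ((1 / sqrt (B x x)) *\<^sub>R x) ((1 / sqrt (B x x)) *\<^sub>R x) = 1"
  using assms by (simp add: B_simps field_simps)

lemma tendsto_T_0:
  assumes "(\<lambda>n. B (f n) (f n)) \<longlonglongrightarrow> 0"
  shows "(\<lambda>n. T (f n)) \<longlonglongrightarrow> 0"
proof -
  have "(\<lambda>n. C * B (f n) (f n)) \<longlonglongrightarrow> C * 0"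
    by (intro tendsto_intros assms)
  then have lim: "(\<lambda>n. C * B (f n) (f n)) \<longlonglongrightarrow> 0"
    by simp
  have "(\<lambda>n. (norm (T (f n)))\<^sup>2) \<longlonglongrightarrow> 0"
    by (rule tendsto_sandwich[OF _ _ tendsto_const lim]) (simp_all add: T_smoothing)
  then have "(\<lambda>n. sqrt ((norm (T (f n)))\<^sup>2)) \<longlonglongrightarrow> sqrt 0"
    by (rule tendsto_real_sqrt)
  then have "(\<lambda>n. norm (T (f n))) \<longlonglongrightarrow> 0"
    by simp
  then show ?thesis
    by (rule tendsto_norm_zero_cancel)
qed

text \<open>Infinitely many such eigenvalues would give a \<open>B\<close>-orthonormal sequence of
  eigenvectors. Their images are orthogonal with squared seminorm at least
  \<open>\<delta>\<^sup>2\<close>, so no subsequence of them converges, against compactness.\<close>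

lemma finite_eigenvalues_away_from_0:
  assumes "0 < \<delta>"
  shows "finite {\<mu>. \<delta> \<le> \<bar>\<mu>\<bar> \<and> (\<exists>x. x \<noteq> 0 \<and> T x = \<mu> *\<^sub>R x)}" (is "finite ?E")
proof (rule ccontr)
  assume "infinite ?E"
  from infinite_countable_subset[OF this] obtain m :: "nat \<Rightarrow> real"
    where m: "inj m" "range m \<subseteq> ?E"
    by (elim exE conjE)
  then have "\<forall>n. m n \<in> ?E"
    by (simp add: subset_iff)
  then have "\<forall>n. \<exists>x. x \<noteq> 0 \<and> T x = m n *\<^sub>R x"
    by simp
  then obtain x where x: "\<And>n. x n \<noteq> 0" "\<And>n. T (x n) = m n *\<^sub>R x n"
    by metis
  have md: "\<delta> \<le> \<bar>m n\<bar>" for n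
    using m by auto
  have pos: "0 < B (x n) (x n)" for n
    using eigenvector_pos[OF x(2) _ x(1)] md[of n] assms by auto
  define y where "y n = (1 / sqrt (B (x n) (x n))) *\<^sub>R x n" for n
  have y1: "B (y n) (y n) = 1" for n
    unfolding y_def by (rule normalize_B[OF pos])
  have Ty: "T (y n) = m n *\<^sub>R y n" for n
    by (simp add: y_def T.scaleR x(2) mult.commute)
  have orth: "B (y n) (y k) = 0" if "n \<noteq> k" for n k
  proof -
    have "m n * B (y n) (y k) = m k * B (y n) (y k)"
      using T_symmetric[of "y n" "y k"] by (simp add: Ty B_simps)
    then show ?thesis
      using that m(1) by (auto dest: injD)
  qed
  obtain r l where r: "strict_mono r" and l: "(\<lambda>n. T (y (r n))) \<longlonglongrightarrow> l"
    using T_compact[of y] y1 by auto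
  \<comment> \<open>For fixed \<open>k\<close>, all later images are orthogonal to the
    \<open>k\<close>-th one, hence so is their limit \<open>l\<close>. Letting \<open>k\<close> tend
    to infinity then makes \<open>l\<close> orthogonal to itself.\<close>
  have "B l (T (y (r k))) = 0" for k
  proof (rule LIMSEQ_unique)
    show "(\<lambda>n. B (T (y (r n))) (T (y (r k)))) \<longlonglongrightarrow> B l (T (y (r k)))"
      by (intro B.tendsto l tendsto_const)
    have "eventually (\<lambda>n. B (T (y (r n))) (T (y (r k))) = 0) sequentially"
      using eventually_gt_at_top[of k]
    proof eventually_elim
      case (elim n)
      then have "r n \<noteq> r k"
        using r by (metis less_irrefl strict_mono_less)
      then show ?case
        by (simp add: Ty B_simps orth)
    qed
    then show "(\<lambda>n. B (T (y (r n))) (T (y (r k)))) \<longlonglongrightarrow> 0"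
      by (rule tendsto_eventually)
  qed
  moreover have "(\<lambda>k. B l (T (y (r k)))) \<longlonglongrightarrow> B l l"
    by (intro B.tendsto l tendsto_const)
  ultimately have "B l l = 0"
    by (simp add: LIMSEQ_const_iff)
  moreover have "\<delta>\<^sup>2 \<le> B l l"
  proof (rule LIMSEQ_le_const)
    show "(\<lambda>n. B (T (y (r n))) (T (y (r n)))) \<longlonglongrightarrow> B l l"
      by (intro B.tendsto l)
    show "\<exists>N. \<forall>n\<ge>N. \<delta>\<^sup>2 \<le> B (T (y (r n))) (T (y (r n)))"
    proof (intro exI allI impI)
      fix n
      have "\<delta>\<^sup>2 \<le> \<bar>m (r n)\<bar>\<^sup>2"
        using md[of "r n"] assms by (intro power_mono) auto
      then show "\<delta>\<^sup>2 \<le> B (T (y (r n))) (T (y (r n)))"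
        by (simp add: Ty B_simps y1 power2_eq_square)
    qed
  qed
  ultimately show False
    using assms by simp
qed

end

section \<open>Inverting \<open>T - \<mu>\<close> on the orthogonal complement of a simple
  eigenvector, and bifurcation\<close>

locale simple_nonzero_eigenvalue = compact_symmetric_operator +
  fixes \<mu> :: real and \<phi> :: 'a
  assumes eigenvalue_nonzero: "\<mu> \<noteq> 0"
    and eigenvector_nonzero: "\<phi> \<noteq> 0"
    and eigenvector: "T \<phi> = \<mu> *\<^sub>R \<phi>"
    and simple: "\<lbrakk>T h = \<mu> *\<^sub>R h; B h \<phi> = 0\<rbrakk> \<Longrightarrow> h = 0"
begin

definition S :: "'a \<Rightarrow> 'a" where "S x = T x - \<mu> *\<^sub>R x"

lemma bounded_linear_S: "bounded_linear S"
  unfolding S_def by (intro bounded_linear_sub bounded_linear_T bounded_linear_scaleR_right)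

sublocale S: bounded_linear S
  by (rule bounded_linear_S)

lemma S_symmetric: "B (S x) y = B x (S y)"
  by (simp add: S_def B_simps T_symmetric)

text \<open>By symmetry the range of \<open>S\<close> is orthogonal to its kernel vector
  \<open>\<phi>\<close>: this is the solvability condition for \<open>S x = b\<close>.\<close>

lemma S_orthogonal: "B (S x) \<phi> = 0"
  by (simp add: S_symmetric, simp add: S_def eigenvector B_simps)

lemma \<phi>_pos: "0 < B \<phi> \<phi>"
  using eigenvector_pos eigenvector eigenvalue_nonzero eigenvector_nonzero by blast

text \<open>Otherwise there are unit vectors orthogonal to \<open>\<phi>\<close> that
  \<open>S\<close> maps to ever smaller seminorm. Compactness gives a limit of their images under
  \<open>T\<close>, which is an eigenvector orthogonal to \<open>\<phi>\<close>, hence zero by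
  simplicity; but then the unit vectors themselves would tend to zero.\<close>

lemma S_bounded_below:
  obtains c where "0 < c" "\<And>x. B x \<phi> = 0 \<Longrightarrow> c * B x x \<le> B (S x) (S x)"
proof -
  have "\<exists>n::nat. \<forall>x. B x \<phi> = 0 \<longrightarrow> 1 / Suc n * B x x \<le> B (S x) (S x)"
  proof (rule ccontr)
    assume "\<not> ?thesis"
    then obtain x where x: "\<And>n. B (x n) \<phi> = 0"
      "\<And>n::nat. B (S (x n)) (S (x n)) < 1 / Suc n * B (x n) (x n)"
      by (metis not_le)
    have pos: "0 < B (x n) (x n)" for n
    proof -
      have "0 < 1 / Suc n * B (x n) (x n)"
        using x(2)[of n] B_nonneg[of "S (x n)"] by linarith
      then show ?thesis
        by (simp add: zero_less_divide_iff)
    qed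
    define y where "y n = (1 / sqrt (B (x n) (x n))) *\<^sub>R x n" for n
    have y1: "B (y n) (y n) = 1" for n
      unfolding y_def by (rule normalize_B[OF pos])
    have y\<phi>: "B (y n) \<phi> = 0" for n
      by (simp add: y_def B_simps x)
    have Sy: "B (S (y n)) (S (y n)) \<le> 1 / Suc n" for n
    proof -
      have "B (S (y n)) (S (y n)) = B (S (x n)) (S (x n)) / B (x n) (x n)"
        using pos[of n] by (simp add: y_def S.scaleR B_simps)
      also have "\<dots> \<le> (1 / Suc n * B (x n) (x n)) / B (x n) (x n)"
        using x(2)[of n] pos[of n] by (intro divide_right_mono) auto
      also have "\<dots> = 1 / Suc n"
        using pos[of n] by simp
      finally show ?thesis .
    qed
    have Sy0: "(\<lambda>n. B (S (y n)) (S (y n))) \<longlonglongrightarrow> 0"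
      using LIMSEQ_inverse_real_of_nat
      by (rule tendsto_sandwich[rotated -1]) (use Sy in \<open>auto simp: B_nonneg inverse_eq_divide\<close>)
    obtain r l where r: "strict_mono r" and l: "(\<lambda>n. T (y (r n))) \<longlonglongrightarrow> l"
      using T_compact[of y] y1 by auto
    have Syr: "(\<lambda>n. B (S (y (r n))) (S (y (r n)))) \<longlonglongrightarrow> 0"
      using LIMSEQ_subseq_LIMSEQ[OF Sy0 r] by (simp add: o_def)
    \<comment> \<open>The vectors \<open>y\<close> need not converge, but \<open>T\<close> and
      \<open>S\<close> commute: \<open>T (S y)\<close> tends to zero by smoothing, and it equals
      \<open>S (T y)\<close>.\<close>
    have "T l - \<mu> *\<^sub>R l = 0"
    proof (rule LIMSEQ_unique)
      show "(\<lambda>n. T (T (y (r n))) - \<mu> *\<^sub>R T (y (r n))) \<longlonglongrightarrow> T l - \<mu> *\<^sub>R l"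
        by (intro tendsto_intros T.tendsto l)
      show "(\<lambda>n. T (T (y (r n))) - \<mu> *\<^sub>R T (y (r n))) \<longlonglongrightarrow> 0"
        using tendsto_T_0[OF Syr] by (simp add: S_def T.diff T.scaleR)
    qed
    moreover have "B l \<phi> = 0"
    proof (rule LIMSEQ_unique)
      show "(\<lambda>n. B (T (y (r n))) \<phi>) \<longlonglongrightarrow> B l \<phi>"
        by (intro B.tendsto l tendsto_const)
      show "(\<lambda>n. B (T (y (r n))) \<phi>) \<longlonglongrightarrow> 0"
        by (simp add: T_symmetric eigenvector B_simps y\<phi>)
    qed
    ultimately have "l = 0"
      using simple[of l] by simp
    then have "(\<lambda>n. B (T (y (r n))) (T (y (r n)))) \<longlonglongrightarrow> B 0 0"
      using l by (intro B.tendsto) auto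
    then have "(\<lambda>n. 2 * B (T (y (r n))) (T (y (r n))) + 2 * B (S (y (r n))) (S (y (r n))))
        \<longlonglongrightarrow> 2 * 0 + 2 * 0"
      by (intro tendsto_intros Syr) (simp add: B_simps)
    \<comment> \<open>Here \<open>\<mu> *\<^sub>R y n\<close> is written as
      \<open>T (y n) - S (y n)\<close>; both parts tend to zero in seminorm, while
      \<open>y n\<close> has seminorm one.\<close>
    moreover have "\<mu>\<^sup>2 \<le> 2 * B (T (y n)) (T (y n)) + 2 * B (S (y n)) (S (y n))" for n
    proof -
      have "\<mu>\<^sup>2 = B (T (y n) - S (y n)) (T (y n) - S (y n))"
        using y1[of n] by (simp add: S_def B_simps power2_eq_square)
      then show ?thesis
        using B_diff_le by metis
    qed
    ultimately have "\<mu>\<^sup>2 \<le> 2 * 0 + 2 * 0"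
      using LIMSEQ_le_const by blast
    then show False
      using eigenvalue_nonzero by simp
  qed
  then obtain n :: nat where "\<And>x. B x \<phi> = 0 \<Longrightarrow> 1 / Suc n * B x x \<le> B (S x) (S x)"
    by blast
  then show thesis
    by (intro that[of "1 / Suc n"]) auto
qed

text \<open>The constant fixes the step size of the descent iteration for
  \<open>S x = b\<close>.\<close>

lemma S_B_bounded:
  obtains \<Lambda> where "0 < \<Lambda>" "\<And>x. B (S x) (S x) \<le> \<Lambda> * B x x"
proof -
  obtain M where M: "0 < M" "\<And>x y. norm (B x y) \<le> norm x * norm y * M"
    using B.pos_bounded by blast
  have "B (S x) (S x) \<le> (2 * M * \<bar>C\<bar> + 2 * \<mu>\<^sup>2) * B x x" for x
  proof -
    have "B (T x) (T x) \<le> (norm (T x))\<^sup>2 * M"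
      using M(2)[of "T x" "T x"] by (simp add: power2_eq_square)
    also have "\<dots> \<le> (\<bar>C\<bar> * B x x) * M"
      using T_smoothing_abs[of x] M(1) by (intro mult_right_mono) auto
    finally have "B (T x) (T x) \<le> (\<bar>C\<bar> * B x x) * M" .
    moreover have "B (S x) (S x) \<le> 2 * B (T x) (T x) + 2 * (\<mu>\<^sup>2 * B x x)"
      using B_diff_le[of "T x" "\<mu> *\<^sub>R x"] by (simp add: S_def B_simps power2_eq_square mult.assoc)
    ultimately show ?thesis
      by (simp add: algebra_simps)
  qed
  moreover have "0 < 2 * M * \<bar>C\<bar> + 2 * \<mu>\<^sup>2"
    using M eigenvalue_nonzero by (intro add_nonneg_pos) auto
  ultimately show thesis
    using that by blast
qed

text \<open>From \<open>\<mu> *\<^sub>R x = T x - S x\<close>, the norm of \<open>x\<close> is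
  controlled by those of \<open>T x\<close> and \<open>S x\<close>. Smoothing bounds the former by
  the seminorm of \<open>x\<close>, hence by the seminorm and then the norm of
  \<open>S x\<close>.\<close>

lemma S_norm_bounded_below:
  obtains K where "0 \<le> K" "\<And>x. B x \<phi> = 0 \<Longrightarrow> norm x \<le> K * norm (S x)"
proof -
  obtain c where c: "0 < c" "\<And>x. B x \<phi> = 0 \<Longrightarrow> c * B x x \<le> B (S x) (S x)"
    using S_bounded_below by blast
  obtain M where M: "0 < M" "\<And>x y. norm (B x y) \<le> norm x * norm y * M"
    using B.pos_bounded by blast
  define K where "K = (sqrt (\<bar>C\<bar> * M / c) + 1) / \<bar>\<mu>\<bar>"
  have "norm x \<le> K * norm (S x)" if "B x \<phi> = 0" for x
  proof -
    have "B x x \<le> B (S x) (S x) / c"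
      using c that by (simp add: field_simps)
    also have "\<dots> \<le> (norm (S x))\<^sup>2 * M / c"
      using M(2)[of "S x" "S x"] c by (intro divide_right_mono) (auto simp: power2_eq_square)
    finally have "\<bar>C\<bar> * B x x \<le> \<bar>C\<bar> * ((norm (S x))\<^sup>2 * M / c)"
      by (rule mult_left_mono) simp
    then have "(norm (T x))\<^sup>2 \<le> (\<bar>C\<bar> * M / c) * (norm (S x))\<^sup>2"
      using T_smoothing_abs[of x] by (simp add: mult_ac)
    then have "sqrt ((norm (T x))\<^sup>2) \<le> sqrt ((\<bar>C\<bar> * M / c) * (norm (S x))\<^sup>2)"
      by (rule real_sqrt_le_mono)
    then have T: "norm (T x) \<le> sqrt (\<bar>C\<bar> * M / c) * norm (S x)"
      by (simp only: real_sqrt_mult real_sqrt_abs abs_norm_cancel)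
    have "\<bar>\<mu>\<bar> * norm x = norm (T x - S x)"
      by (simp add: S_def)
    also have "\<dots> \<le> norm (T x) + norm (S x)"
      by (rule norm_triangle_ineq4)
    also have "\<dots> \<le> (sqrt (\<bar>C\<bar> * M / c) + 1) * norm (S x)"
      using T by (simp add: algebra_simps)
    finally show ?thesis
      using eigenvalue_nonzero by (simp add: K_def field_simps)
  qed
  moreover have "0 \<le> K"
    using M c by (simp add: K_def)
  ultimately show thesis
    using that by blast
qed

text \<open>The equation \<open>S x = b\<close> is solved by gradient descent for the seminorm of the residual;
  since \<open>T\<close> maps seminorm-Cauchy sequences to norm-Cauchy ones, the limit is a genuine vector.\<close>
lemma S_surjective:
  assumes b: "B b \<phi> = 0"
  shows "\<exists>x. B x \<phi> = 0 \<and> S x = b"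
proof -
  obtain c where c: "0 < c" "\<And>x. B x \<phi> = 0 \<Longrightarrow> c * B x x \<le> B (S x) (S x)"
    using S_bounded_below by blast
  obtain \<Lambda> where \<Lambda>: "0 < \<Lambda>" "\<And>x. B (S x) (S x) \<le> \<Lambda> * B x x"
    using S_B_bounded by blast
  \<comment> \<open>As \<open>S\<close> is symmetric, \<open>S (b - S y)\<close> is the direction of
    steepest descent of the squared residual, up to a factor.\<close>
  define x where "x = rec_nat 0 (\<lambda>_ y. y + (1 / \<Lambda>) *\<^sub>R S (b - S y))"
  define \<rho> where "\<rho> n = b - S (x n)" for n
  have x_0: "x 0 = 0" and x_Suc: "x (Suc n) = x n + (1 / \<Lambda>) *\<^sub>R S (\<rho> n)" for n
    by (simp_all add: x_def \<rho>_def)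
  have x\<phi>: "B (x n) \<phi> = 0" for n
    by (induction n) (simp_all add: x_0 x_Suc B_simps S_orthogonal)
  have \<rho>\<phi>: "B (\<rho> n) \<phi> = 0" for n
    by (simp add: \<rho>_def B_simps b S_orthogonal)
  have \<rho>_Suc: "\<rho> (Suc n) = \<rho> n - (1 / \<Lambda>) *\<^sub>R S (S (\<rho> n))" for n
    by (simp add: \<rho>_def x_Suc S.add S.scaleR)
  \<comment> \<open>The maximum keeps the rate nonnegative: \<open>c\<close> is at most
    \<open>\<Lambda>\<close> as soon as some vector orthogonal to \<open>\<phi>\<close> has positive
    seminorm, but nothing guarantees such a vector.\<close>
  define q where "q = max 0 (1 - c / \<Lambda>)"
  have q: "0 \<le> q" "q < 1"
    using c \<Lambda> by (auto simp: q_def)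
  have \<rho>_step: "B (\<rho> (Suc n)) (\<rho> (Suc n)) \<le> q * B (\<rho> n) (\<rho> n)" for n
  proof -
    have "B (\<rho> (Suc n)) (\<rho> (Suc n)) =
        B (\<rho> n) (\<rho> n) - 2 / \<Lambda> * B (S (\<rho> n)) (S (\<rho> n))
          + (1 / \<Lambda>)\<^sup>2 * B (S (S (\<rho> n))) (S (S (\<rho> n)))"
      by (simp add: \<rho>_Suc B_simps S_symmetric[of "S (\<rho> n)" "\<rho> n"] S_symmetric[symmetric, of "\<rho> n"]
          power2_eq_square algebra_simps)
    also have "\<dots> \<le> B (\<rho> n) (\<rho> n) - 2 / \<Lambda> * B (S (\<rho> n)) (S (\<rho> n))
          + (1 / \<Lambda>)\<^sup>2 * (\<Lambda> * B (S (\<rho> n)) (S (\<rho> n)))"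
      by (intro add_left_mono mult_left_mono \<Lambda>) auto
    also have "\<dots> = B (\<rho> n) (\<rho> n) - B (S (\<rho> n)) (S (\<rho> n)) / \<Lambda>"
      using \<Lambda>(1) by (simp add: power2_eq_square field_simps)
    also have "\<dots> \<le> B (\<rho> n) (\<rho> n) - c * B (\<rho> n) (\<rho> n) / \<Lambda>"
      using c(2)[OF \<rho>\<phi>] \<Lambda>(1) by (intro diff_left_mono divide_right_mono) auto
    also have "\<dots> = (1 - c / \<Lambda>) * B (\<rho> n) (\<rho> n)"
      by (simp add: algebra_simps)
    also have "\<dots> \<le> q * B (\<rho> n) (\<rho> n)"
      unfolding q_def by (intro mult_right_mono B_nonneg) auto
    finally show ?thesis .
  qed
  have \<rho>_le: "B (\<rho> n) (\<rho> n) \<le> q ^ n * B b b" for n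
  proof (induction n)
    case 0
    then show ?case by (simp add: \<rho>_def x_0 S.zero)
  next
    case (Suc n)
    have "B (\<rho> (Suc n)) (\<rho> (Suc n)) \<le> q * B (\<rho> n) (\<rho> n)"
      by (rule \<rho>_step)
    also have "\<dots> \<le> q * (q ^ n * B b b)"
      using Suc q by (intro mult_left_mono) auto
    finally show ?case by (simp add: mult_ac)
  qed
  have "(\<lambda>n. B (\<rho> n) (\<rho> n)) \<longlonglongrightarrow> 0"
  proof (rule tendsto_sandwich[OF _ _ tendsto_const])
    show "(\<lambda>n. q ^ n * B b b) \<longlonglongrightarrow> 0"
      using q by (intro tendsto_mult_left_zero LIMSEQ_realpow_zero)
  qed (simp_all add: B_nonneg \<rho>_le)
  then have T\<rho>: "(\<lambda>n. T (\<rho> n)) \<longlonglongrightarrow> 0"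
    by (rule tendsto_T_0)
  \<comment> \<open>The increments of the iteration are multiples of \<open>S (\<rho> n)\<close>,
    whose seminorm decays like \<open>sqrt q ^ n\<close>; applying \<open>T\<close> turns this into
    decay in norm.\<close>
  have "summable (\<lambda>n. T (x (Suc n)) - T (x n))"
  proof (rule summable_comparison_test)
    show "\<exists>N. \<forall>n\<ge>N. norm (T (x (Suc n)) - T (x n))
        \<le> (1 / \<Lambda>) * sqrt (\<bar>C\<bar> * \<Lambda> * B b b) * sqrt q ^ n"
    proof (intro exI allI impI)
      fix n
      have "(norm (T (S (\<rho> n))))\<^sup>2 \<le> \<bar>C\<bar> * B (S (\<rho> n)) (S (\<rho> n))"
        by (rule T_smoothing_abs)
      also have "\<dots> \<le> \<bar>C\<bar> * (\<Lambda> * (q ^ n * B b b))"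
        using \<Lambda>(1) by (intro mult_left_mono order_trans[OF \<Lambda>(2)] \<rho>_le) auto
      finally have "sqrt ((norm (T (S (\<rho> n))))\<^sup>2) \<le> sqrt (\<bar>C\<bar> * \<Lambda> * B b b * q ^ n)"
        by (intro real_sqrt_le_mono) (simp add: mult_ac)
      then have "norm (T (S (\<rho> n))) \<le> sqrt (\<bar>C\<bar> * \<Lambda> * B b b) * sqrt q ^ n"
        by (simp add: real_sqrt_mult real_sqrt_power)
      then have "(1 / \<Lambda>) * norm (T (S (\<rho> n))) \<le> (1 / \<Lambda>) * (sqrt (\<bar>C\<bar> * \<Lambda> * B b b) * sqrt q ^ n)"
        using \<Lambda>(1) by (intro mult_left_mono) auto
      then show "norm (T (x (Suc n)) - T (x n))
          \<le> (1 / \<Lambda>) * sqrt (\<bar>C\<bar> * \<Lambda> * B b b) * sqrt q ^ n"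
        using \<Lambda>(1) by (simp add: x_Suc T.add T.scaleR)
    qed
    show "summable (\<lambda>n. (1 / \<Lambda>) * sqrt (\<bar>C\<bar> * \<Lambda> * B b b) * sqrt q ^ n)"
      using q by (intro summable_mult summable_geometric) (simp add: real_sqrt_lt_1_iff)
  qed
  then have "convergent (\<lambda>n. \<Sum>i<n. T (x (Suc i)) - T (x i))"
    by (simp add: summable_iff_convergent)
  then obtain y where y: "(\<lambda>n. T (x n)) \<longlonglongrightarrow> y"
    by (auto simp: sum_lessThan_telescope[of "\<lambda>n. T (x n)"] x_0 T.zero convergent_def)
  \<comment> \<open>Only the images \<open>T (x n)\<close> are known to converge in norm. The
    equation \<open>S z = b\<close> means that \<open>z\<close> is \<open>T z - b\<close> divided by
    \<open>\<mu>\<close>, so the limit \<open>y\<close> is put in the place of \<open>T z\<close>;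
    that \<open>T z = y\<close> is then checked by passing to the limit.\<close>
  define z where "z = (1 / \<mu>) *\<^sub>R (y - b)"
  have "T z = y"
  proof (rule LIMSEQ_unique[OF _ y])
    have "T (x n) = (1 / \<mu>) *\<^sub>R (T (T (x n)) - T b + T (\<rho> n))" for n
    proof -
      have "T b - T (\<rho> n) = T (S (x n))"
        by (simp add: \<rho>_def T.diff)
      also have "\<dots> = T (T (x n)) - \<mu> *\<^sub>R T (x n)"
        by (simp add: S_def T.diff T.scaleR)
      finally have "\<mu> *\<^sub>R T (x n) = T (T (x n)) - T b + T (\<rho> n)"
        by (simp add: algebra_simps)
      then show ?thesis
        using eigenvalue_nonzero by (metis scaleR_scaleR divide_self_if mult.commute scaleR_one
          times_divide_eq_right mult_1_right)
    qed
    moreover have "(\<lambda>n. (1 / \<mu>) *\<^sub>R (T (T (x n)) - T b + T (\<rho> n))) \<longlonglongrightarrow> (1 / \<mu>) *\<^sub>R (T y - T b + 0)"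
      by (intro tendsto_intros T.tendsto y T\<rho>)
    ultimately show "(\<lambda>n. T (x n)) \<longlonglongrightarrow> T z"
      by (simp add: z_def T.scaleR T.diff)
  qed
  then have "S z = b"
    using eigenvalue_nonzero by (simp add: S_def z_def)
  moreover have "B y \<phi> = 0"
  proof (rule LIMSEQ_unique)
    show "(\<lambda>n. B (T (x n)) \<phi>) \<longlonglongrightarrow> B y \<phi>"
      by (intro B.tendsto y tendsto_const)
    show "(\<lambda>n. B (T (x n)) \<phi>) \<longlonglongrightarrow> 0"
      by (simp add: T_symmetric eigenvector B_simps x\<phi>)
  qed
  then have "B z \<phi> = 0"
    by (simp add: z_def B_simps b)
  ultimately show ?thesis by blast
qed

text \<open>\<open>A\<close> is merely chosen pointwise. Its Lipschitz bound comes from the lower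
  bound for \<open>S\<close> at \<open>A b - A b'\<close>, whose image is
  \<open>b - b'\<close>.\<close>

lemma S_inverse:
  obtains A K where "0 \<le> K"
    "\<And>b. B b \<phi> = 0 \<Longrightarrow> B (A b) \<phi> = 0"
    "\<And>b. B b \<phi> = 0 \<Longrightarrow> S (A b) = b"
    "\<And>b b'. B b \<phi> = 0 \<Longrightarrow> B b' \<phi> = 0 \<Longrightarrow> norm (A b - A b') \<le> K * norm (b - b')"
    "A 0 = 0"
proof -
  obtain K where K: "0 \<le> K" "\<And>x. B x \<phi> = 0 \<Longrightarrow> norm x \<le> K * norm (S x)"
    using S_norm_bounded_below by blast
  obtain A where A: "\<And>b. B b \<phi> = 0 \<Longrightarrow> B (A b) \<phi> = 0 \<and> S (A b) = b"
    using S_surjective by metis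
  have lip: "norm (A b - A b') \<le> K * norm (b - b')" if "B b \<phi> = 0" "B b' \<phi> = 0" for b b'
    using K(2)[of "A b - A b'"] A[OF that(1)] A[OF that(2)] by (simp add: B_simps S.diff)
  have "norm (A 0) \<le> K * norm (S (A 0))"
    using A[of 0] K(2)[of "A 0"] by (simp add: B_simps)
  then have "A 0 = 0"
    using A[of 0] by (simp add: B_simps)
  then show thesis
    using that[of K A] K(1) A lip by blast
qed

text \<open>The hypothesis on \<open>N - T\<close> says that it is Lipschitz on small balls with a
  constant proportional to the radius, which is how \<open>T\<close> is encoded as the derivative at
  0. After rescaling by the amplitude \<open>s\<close>, the nonlinear part becomes a perturbation of
  order \<open>s\<close>.\<close>

theorem bifurcation:
  assumes N_0: "N 0 = 0"
    and N_T: "\<And>x y. \<lbrakk>norm x \<le> 1; norm y \<le> 1\<rbrakk> \<Longrightarrow>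
      norm ((N x - T x) - (N y - T y)) \<le> L * (norm x + norm y) * norm (x - y)"
    and "0 < \<epsilon>"
  shows "\<exists>g \<nu>. g \<noteq> 0 \<and> norm g < \<epsilon> \<and> \<bar>\<nu> - \<mu>\<bar> < \<epsilon> \<and> N g = \<nu> *\<^sub>R g"
proof -
  obtain A K where K: "0 \<le> K"
    and A: "\<And>b. B b \<phi> = 0 \<Longrightarrow> B (A b) \<phi> = 0" "\<And>b. B b \<phi> = 0 \<Longrightarrow> S (A b) = b"
      "\<And>b b'. B b \<phi> = 0 \<Longrightarrow> B b' \<phi> = 0 \<Longrightarrow> norm (A b - A b') \<le> K * norm (b - b')"
    and A_0: "A 0 = 0"
    by (rule S_inverse) (rule that)
  obtain M where M: "0 < M" "\<And>x y. norm (B x y) \<le> norm x * norm y * M"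
    using B.pos_bounded by blast
  \<comment> \<open>The coefficient along \<open>\<phi>\<close> of the orthogonal projection;
    \<open>P\<close> bounds it in norm.\<close>
  define p where "p x = B x \<phi> / B \<phi> \<phi>" for x
  define P where "P = norm \<phi> * M / B \<phi> \<phi>"
  have P: "0 \<le> P"
    using M \<phi>_pos by (simp add: P_def)
  have p_diff: "p (x - y) = p x - p y" for x y
    by (simp add: p_def B_simps diff_divide_distrib)
  have p_le: "\<bar>p x\<bar> \<le> P * norm x" for x
    using M(2)[of x \<phi>] \<phi>_pos by (simp add: p_def P_def divide_right_mono mult_ac)
  define R where "R = norm \<phi> + 1"
  have R: "1 \<le> R" by (simp add: R_def)
  define L' where "L' = \<bar>L\<bar> + 1"
  have L': "0 < L'" by (simp add: L'_def)
  define G where "G = L' * R * R + 1"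
  have G: "0 < G" using L' R by (simp add: G_def add_pos_pos)
  have N_T': "norm ((N x - T x) - (N y - T y)) \<le> L' * (norm x + norm y) * norm (x - y)"
    if "norm x \<le> 1" "norm y \<le> 1" for x y
    using N_T[OF that] by (rule order_trans) (auto intro!: mult_right_mono simp: L'_def)
  text \<open>All constants below are linear in \<open>s\<close>, so a small amplitude makes the fixed-point map a
    contraction.\<close>
  define H where "H = K * (P * (2 * L' * R) + P * G + 2 * L' * R + P * (2 * L' * R) * norm \<phi>)
      + K * (P * G + G + P * G * norm \<phi>) + P * G + R + 1"
  have "\<exists>s>0. s * H < min 1 \<epsilon> / 2"
  proof (intro exI conjI)
    have H: "0 < H"
      unfolding H_def using K P L' R G by (intro add_nonneg_pos add_nonneg_nonneg mult_nonneg_nonneg) auto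
    show "0 < min 1 \<epsilon> / (4 * H)"
      using H \<open>0 < \<epsilon>\<close> by simp
    show "min 1 \<epsilon> / (4 * H) * H < min 1 \<epsilon> / 2"
      using H \<open>0 < \<epsilon>\<close> by (simp add: min_def)
  qed
  then obtain s where s: "0 < s" "s * H < min 1 \<epsilon> / 2" by blast
  have part: "s * h \<le> s * H \<and> s * h < 1/2 \<and> s * h < \<epsilon>" if "h \<le> H" for h
  proof -
    have "s * h \<le> s * H" using s that by simp
    moreover have "min 1 \<epsilon> / 2 \<le> 1/2" "min 1 \<epsilon> / 2 < \<epsilon>"
      using \<open>0 < \<epsilon>\<close> by (auto simp: min_def)
    ultimately show ?thesis using s by linarith
  qed
  have nn: "0 \<le> K * (P * (2 * L' * R) + P * G + 2 * L' * R + P * (2 * L' * R) * norm \<phi>)"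
    "0 \<le> K * (P * G + G + P * G * norm \<phi>)" "0 \<le> P * G"
    using K P L' R G by (auto intro!: mult_nonneg_nonneg add_nonneg_nonneg)
  have sR: "s * R < 1/2" "s * R < \<epsilon>"
    using part[of R] nn by (auto simp: H_def)
  have sPG: "s * (P * G) < \<epsilon>"
    using part[of "P * G"] nn R by (auto simp: H_def)
  have s1: "s * (K * (P * G + G + P * G * norm \<phi>)) < 1/2"
    using part[of "K * (P * G + G + P * G * norm \<phi>)"] nn R by (auto simp: H_def)
  have s2: "s * (K * (P * (2 * L' * R) + P * G + 2 * L' * R + P * (2 * L' * R) * norm \<phi>)) < 1/2"
    using part[of "K * (P * (2 * L' * R) + P * G + 2 * L' * R + P * (2 * L' * R) * norm \<phi>)"] nn R
    by (auto simp: H_def)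
  define X where "X = {w. B w \<phi> = 0 \<and> norm w \<le> 1}"
  \<comment> \<open>With this, \<open>N g = \<nu> *\<^sub>R g\<close> for
    \<open>g = s *\<^sub>R (\<phi> + w)\<close> reads
    \<open>T (\<phi> + w) + F w = \<nu> *\<^sub>R (\<phi> + w)\<close>.\<close>
  define F where "F w = (1 / s) *\<^sub>R (N (s *\<^sub>R (\<phi> + w)) - T (s *\<^sub>R (\<phi> + w)))" for w
  have nR: "norm (s *\<^sub>R (\<phi> + w)) \<le> s * R" if "norm w \<le> 1" for w
    using s that norm_triangle_ineq[of \<phi> w] by (simp add: R_def)
  have F_lip: "norm (F w - F w') \<le> s * (2 * L' * R) * norm (w - w')"
    if "norm w \<le> 1" "norm w' \<le> 1" for w w'
  proof -
    let ?x = "s *\<^sub>R (\<phi> + w)" and ?y = "s *\<^sub>R (\<phi> + w')"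
    have "norm ((N ?x - T ?x) - (N ?y - T ?y)) \<le> L' * (norm ?x + norm ?y) * norm (?x - ?y)"
      using nR[OF that(1)] nR[OF that(2)] sR by (intro N_T') auto
    also have "\<dots> \<le> L' * (s * R + s * R) * norm (?x - ?y)"
      using nR[OF that(1)] nR[OF that(2)] L' by (intro mult_right_mono mult_left_mono add_mono) auto
    also have "?x - ?y = s *\<^sub>R (w - w')"
      by (simp add: algebra_simps)
    finally have "norm ((N ?x - T ?x) - (N ?y - T ?y)) \<le> s * (s * (2 * L' * R) * norm (w - w'))"
      using s by (simp add: mult_ac)
    moreover have "norm ((N ?x - T ?x) - (N ?y - T ?y)) = s * norm (F w - F w')"
      using s unfolding F_def scaleR_diff_right[symmetric] by simp
    ultimately have "s * norm (F w - F w') \<le> s * (s * (2 * L' * R) * norm (w - w'))"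
      by (simp only:)
    then show ?thesis
      using s(1) by (rule mult_left_le_imp_le)
  qed
  have F_le: "norm (F w) \<le> s * G" if "norm w \<le> 1" for w
  proof -
    let ?x = "s *\<^sub>R (\<phi> + w)"
    have "norm ((N ?x - T ?x) - (N 0 - T 0)) \<le> L' * (norm ?x + norm (0::'a)) * norm (?x - 0)"
      using nR[OF that] sR by (intro N_T') auto
    also have "\<dots> = L' * (norm ?x * norm ?x)"
      by simp
    also have "\<dots> \<le> L' * ((s * R) * (s * R))"
      using nR[OF that] L' s R by (intro mult_left_mono mult_mono) auto
    finally have "norm (N ?x - T ?x) \<le> s * (s * (L' * R * R))"
      by (simp add: N_0 T.zero mult_ac)
    moreover have "norm (N ?x - T ?x) = s * norm (F w)"
      using s unfolding F_def by simp
    ultimately have "s * norm (F w) \<le> s * (s * (L' * R * R))"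
      by (simp only:)
    then have "norm (F w) \<le> s * (L' * R * R)"
      using s(1) by (rule mult_left_le_imp_le)
    also have "\<dots> \<le> s * G"
      using s by (simp add: G_def)
    finally show ?thesis .
  qed
  \<comment> \<open>Pairing the rescaled equation with \<open>\<phi>\<close> forces
    \<open>\<nu> = \<mu> + p (F w)\<close>, because \<open>w\<close> and \<open>T w\<close> are
    orthogonal to \<open>\<phi>\<close>. With this \<open>\<nu>\<close> substituted, the equation
    becomes \<open>S w = b w\<close>, and the last summand makes the right-hand side orthogonal to
    \<open>\<phi>\<close>.\<close>
  define b where "b w = p (F w) *\<^sub>R w - F w + p (F w) *\<^sub>R \<phi>" for w
  have b\<phi>: "B (b w) \<phi> = 0" if "B w \<phi> = 0" for w
    using \<phi>_pos that by (simp add: b_def p_def B_simps)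
  have pF_lip: "\<bar>p (F w) - p (F w')\<bar> \<le> P * (s * (2 * L' * R) * norm (w - w'))"
    if "norm w \<le> 1" "norm w' \<le> 1" for w w'
    using p_le[of "F w - F w'"] mult_left_mono[OF F_lip[OF that] P] by (simp add: p_diff)
  have pF_le: "\<bar>p (F w)\<bar> \<le> P * (s * G)" if "norm w \<le> 1" for w
    using p_le[of "F w"] mult_left_mono[OF F_le[OF that] P] by linarith
  have b_le: "norm (b w) \<le> s * (P * G + G + P * G * norm \<phi>)" if "norm w \<le> 1" for w
  proof -
    have "norm (b w) \<le> \<bar>p (F w)\<bar> * norm w + norm (F w) + \<bar>p (F w)\<bar> * norm \<phi>"
      unfolding b_def by (smt (verit) norm_scaleR norm_triangle_ineq norm_triangle_ineq4)
    also have "\<dots> \<le> P * (s * G) * 1 + s * G + P * (s * G) * norm \<phi>"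
      using that pF_le[OF that] F_le[OF that] by (intro add_mono mult_mono) auto
    finally show ?thesis by (simp add: algebra_simps)
  qed
  have b_lip: "norm (b w - b w')
      \<le> s * (P * (2 * L' * R) + P * G + 2 * L' * R + P * (2 * L' * R) * norm \<phi>) * norm (w - w')"
    if "norm w \<le> 1" "norm w' \<le> 1" for w w'
  proof -
    have "b w - b w' = (p (F w) - p (F w')) *\<^sub>R w + p (F w') *\<^sub>R (w - w') - (F w - F w')
        + (p (F w) - p (F w')) *\<^sub>R \<phi>"
      by (simp add: b_def algebra_simps)
    then have "norm (b w - b w') \<le> \<bar>p (F w) - p (F w')\<bar> * norm w + \<bar>p (F w')\<bar> * norm (w - w')
        + norm (F w - F w') + \<bar>p (F w) - p (F w')\<bar> * norm \<phi>"
      by (smt (verit) norm_scaleR norm_triangle_ineq norm_triangle_ineq4)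
    also have "\<dots> \<le> P * (s * (2 * L' * R) * norm (w - w')) * 1 + P * (s * G) * norm (w - w')
        + s * (2 * L' * R) * norm (w - w') + P * (s * (2 * L' * R) * norm (w - w')) * norm \<phi>"
      using that pF_le[OF that(2)] F_lip[OF that] pF_lip[OF that] s P L' R
      by (intro add_mono mult_mono) auto
    finally show ?thesis by (simp add: algebra_simps)
  qed
  have "\<exists>!w\<in>X. A (b w) = w"
  proof (rule Banach_fix)
    have "closed X"
      unfolding X_def Collect_conj_eq
      by (intro closed_Int closed_Collect_eq closed_Collect_le continuous_intros B.continuous_on)
    then show "complete X"
      by (simp add: complete_eq_closed)
    show "X \<noteq> {}"
      by (auto simp: X_def B_simps intro!: exI[of _ 0])
    show "(\<lambda>w. A (b w)) ` X \<subseteq> X"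
    proof (rule image_subsetI)
      fix w assume w: "w \<in> X"
      have "norm (A (b w) - A 0) \<le> K * norm (b w - 0)"
        using w b\<phi> by (intro A) (auto simp: X_def B_simps)
      also have "\<dots> \<le> K * (s * (P * G + G + P * G * norm \<phi>))"
        using w b_le K by (intro mult_left_mono) (auto simp: X_def)
      also have "\<dots> = s * (K * (P * G + G + P * G * norm \<phi>))"
        by (simp only: mult_ac)
      also have "\<dots> \<le> 1"
        using s1 by linarith
      finally show "A (b w) \<in> X"
        using w b\<phi> A(1) by (auto simp: X_def A_0)
    qed
    show "dist (A (b w)) (A (b w')) \<le> 1/2 * dist w w'" if w: "w \<in> X" "w' \<in> X" for w w'
    proof -
      have "norm (A (b w) - A (b w')) \<le> K * norm (b w - b w')"
        using w b\<phi> by (intro A) (auto simp: X_def)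
      also have "\<dots> \<le> K * (s * (P * (2 * L' * R) + P * G + 2 * L' * R + P * (2 * L' * R) * norm \<phi>)
          * norm (w - w'))"
        using w b_lip K by (intro mult_left_mono) (auto simp: X_def)
      also have "\<dots> = (s * (K * (P * (2 * L' * R) + P * G + 2 * L' * R + P * (2 * L' * R) * norm \<phi>)))
          * norm (w - w')"
        by (simp only: mult_ac)
      also have "\<dots> \<le> 1/2 * norm (w - w')"
        using s2 by (intro mult_right_mono) auto
      finally show "dist (A (b w)) (A (b w')) \<le> 1/2 * dist w w'"
        by (simp add: dist_norm)
    qed
  qed auto
  then obtain w where w: "B w \<phi> = 0" "norm w \<le> 1" "A (b w) = w"
    by (auto simp: X_def)
  let ?g = "s *\<^sub>R (\<phi> + w)" and ?\<nu> = "\<mu> + p (F w)"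
  have "S w = b w"
    using A(2)[OF b\<phi>[OF w(1)]] w(3) by simp
  then have "T w = \<mu> *\<^sub>R w + p (F w) *\<^sub>R w - F w + p (F w) *\<^sub>R \<phi>"
    by (simp add: S_def b_def algebra_simps)
  then have "T (\<phi> + w) + F w = ?\<nu> *\<^sub>R (\<phi> + w)"
    by (simp add: T.add eigenvector algebra_simps)
  then have "s *\<^sub>R (T (\<phi> + w) + F w) = ?\<nu> *\<^sub>R ?g"
    by (simp add: mult.commute)
  moreover have "s *\<^sub>R (T (\<phi> + w) + F w) = N ?g"
    using s(1) unfolding F_def scaleR_add_right by (simp add: T.scaleR T.add algebra_simps)
  ultimately have "N ?g = ?\<nu> *\<^sub>R ?g" by simp
  moreover have "?g \<noteq> 0"
  proof
    assume "?g = 0"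
    then have "B (\<phi> + w) \<phi> = 0"
      using s by (simp add: B_simps)
    then show False
      using \<phi>_pos w(1) by (simp add: B_simps)
  qed
  moreover have "norm ?g < \<epsilon>"
    using nR[OF w(2)] sR by linarith
  moreover have "\<bar>?\<nu> - \<mu>\<bar> < \<epsilon>"
    using pF_le[OF w(2)] sPG by (simp add: mult_ac)
  ultimately show ?thesis by blast
qed

end

section \<open>Integral operators with a symmetric kernel\<close>

instance bcontfun :: (metric_space, banach) banach ..

lemma integrable_mult_of_squares:
  fixes a b :: "'a \<Rightarrow> real"
  assumes [measurable]: "a \<in> borel_measurable M" "b \<in> borel_measurable M"
    and "integrable M (\<lambda>x. (a x)\<^sup>2)" "integrable M (\<lambda>x. (b x)\<^sup>2)"
  shows "integrable M (\<lambda>x. a x * b x)"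
proof (rule Bochner_Integration.integrable_bound)
  show "integrable M (\<lambda>x. (a x)\<^sup>2 + (b x)\<^sup>2)"
    using assms by simp
  show "AE x in M. norm (a x * b x) \<le> norm ((a x)\<^sup>2 + (b x)\<^sup>2)"
  proof (rule AE_I2)
    fix x
    have "2 * (\<bar>a x\<bar> * \<bar>b x\<bar>) \<le> (a x)\<^sup>2 + (b x)\<^sup>2"
      using sum_squares_bound[of "\<bar>a x\<bar>" "\<bar>b x\<bar>"] by simp
    moreover have "0 \<le> \<bar>a x\<bar> * \<bar>b x\<bar>" by simp
    ultimately have "\<bar>a x\<bar> * \<bar>b x\<bar> \<le> (a x)\<^sup>2 + (b x)\<^sup>2"
      by linarith
    then show "norm (a x * b x) \<le> norm ((a x)\<^sup>2 + (b x)\<^sup>2)"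
      by (simp add: abs_mult)
  qed
qed measurable

lemma Cauchy_Schwarz_integral:
  fixes a b :: "'a \<Rightarrow> real"
  assumes [measurable]: "a \<in> borel_measurable M" "b \<in> borel_measurable M"
    and a: "integrable M (\<lambda>x. (a x)\<^sup>2)" and b: "integrable M (\<lambda>x. (b x)\<^sup>2)"
  shows "(\<integral>x. a x * b x \<partial>M)\<^sup>2 \<le> (\<integral>x. (a x)\<^sup>2 \<partial>M) * (\<integral>x. (b x)\<^sup>2 \<partial>M)"
proof -
  let ?P = "\<integral>x. a x * b x \<partial>M" and ?A = "\<integral>x. (a x)\<^sup>2 \<partial>M" and ?B = "\<integral>x. (b x)\<^sup>2 \<partial>M"
  have ab: "integrable M (\<lambda>x. a x * b x)"
    by (rule integrable_mult_of_squares) (use assms in auto)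
  have quad: "0 \<le> ?A - 2 * t * ?P + t\<^sup>2 * ?B" for t
  proof -
    have "0 \<le> (\<integral>x. (a x - t * b x)\<^sup>2 \<partial>M)"
      by simp
    also have "\<dots> = (\<integral>x. (a x)\<^sup>2 - (2 * t) * (a x * b x) + t\<^sup>2 * (b x)\<^sup>2 \<partial>M)"
      by (simp add: power2_eq_square algebra_simps)
    also have "\<dots> = ?A - 2 * t * ?P + t\<^sup>2 * ?B"
      using a b ab by simp
    finally show ?thesis .
  qed
  have B: "0 \<le> ?B" by simp
  show ?thesis
  proof (cases "?B = 0")
    case True
    have "?P = 0"
    proof (rule ccontr)
      assume "?P \<noteq> 0"
      \<comment> \<open>At this parameter the remaining linear expression takes the value
        -1.\<close>
      with quad[of "(?A + 1) / (2 * ?P)"] True show False by simp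
    qed
    then show ?thesis using True by simp
  next
    case False
    then have "0 < ?B" using B by linarith
    with quad[of "?P / ?B"] show ?thesis
      by (simp add: power2_eq_square field_simps)
  qed
qed

text \<open>The domain is the whole space, so Arzela-Ascoli does not apply directly.
  \<open>K_represented\<close> repairs this: each row of the kernel already occurs at a point of the
  compact set, so every value of an image function is attained there, and uniform convergence on
  that set is uniform convergence everywhere.\<close>

locale symmetric_integral_operator = finite_measure M
  for M :: "'a::euclidean_space measure" +
  fixes S :: "'a set" and K :: "'a \<Rightarrow> 'a \<Rightarrow> real" and k :: real
  assumes sets_M: "sets M = sets borel"
    and compact_S: "compact S"
    and K_measurable: "(\<lambda>(z, w). K z w) \<in> borel_measurable (borel \<Otimes>\<^sub>M borel)"
    and K_bound: "\<bar>K z w\<bar> \<le> k"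
    and K_commute: "K z w = K w z"
    and K_L1_continuous: "0 < \<epsilon> \<Longrightarrow>
      \<exists>\<delta>>0. \<forall>z z'. dist z z' < \<delta> \<longrightarrow> (\<integral>w. \<bar>K z w - K z' w\<bar> \<partial>M) < \<epsilon>"
    and K_represented: "\<exists>z'\<in>S. K z = K z'"
begin

lemma measurable_M [simp]: "measurable M N = measurable borel N"
  by (rule measurable_cong_sets) (simp_all add: sets_M)

lemma k_nonneg: "0 \<le> k"
  using K_bound[of undefined undefined] by linarith

lemma K_measurable_pair [measurable]:
  assumes [measurable]: "f \<in> borel_measurable N" "g \<in> borel_measurable N"
  shows "(\<lambda>x. K (f x) (g x)) \<in> borel_measurable N"
  using measurable_compose[OF _ K_measurable, of "\<lambda>x. (f x, g x)" N] by simp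

lemma bcontfun_measurable [measurable]: "apply_bcontfun (f :: 'a \<Rightarrow>\<^sub>C real) \<in> borel_measurable borel"
  by (rule borel_measurable_continuous_onI) simp

lemma bcontfun_abs_le: "\<bar>apply_bcontfun f x\<bar> \<le> norm f" for f :: "'a \<Rightarrow>\<^sub>C real"
  using norm_bounded[of f x] by simp

lemma integrable_bounded:
  fixes f :: "'a \<Rightarrow> real"
  assumes "f \<in> borel_measurable borel" "\<And>x. \<bar>f x\<bar> \<le> c"
  shows "integrable M f"
  by (rule integrable_const_bound[of _ c]) (use assms in simp_all)

lemma integrable_mult_bcontfun [simp]: "integrable M (\<lambda>w. f w * g w)" for f g :: "'a \<Rightarrow>\<^sub>C real"
  by (rule integrable_bounded[of _ "norm f * norm g"])
    (auto simp: abs_mult intro!: mult_mono bcontfun_abs_le)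

lemma integrable_K_bcontfun [simp]: "integrable M (\<lambda>w. K z w * f w)" for f :: "'a \<Rightarrow>\<^sub>C real"
  by (rule integrable_bounded[of _ "k * norm f"])
    (auto simp: abs_mult k_nonneg intro!: mult_mono bcontfun_abs_le K_bound)

lemma integrable_K_diff_sq: "integrable M (\<lambda>w. (K z w - K z' w)\<^sup>2)"
proof (rule integrable_bounded[of _ "(2 * k)\<^sup>2"])
  show "\<bar>(K z w - K z' w)\<^sup>2\<bar> \<le> (2 * k)\<^sup>2" for w
    using K_bound[of z w] K_bound[of z' w]
    by (subst abs_of_nonneg, simp, intro abs_le_square_iff[THEN iffD1]) auto
qed measurable

lemma integrable_abs_K_diff: "integrable M (\<lambda>w. \<bar>K z w - K z' w\<bar>)"
proof (rule integrable_bounded[of _ "2 * k"])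
  show "\<bar>\<bar>K z w - K z' w\<bar>\<bar> \<le> 2 * k" for w
    using K_bound[of z w] K_bound[of z' w] by simp
qed measurable

definition B :: "('a \<Rightarrow>\<^sub>C real) \<Rightarrow> ('a \<Rightarrow>\<^sub>C real) \<Rightarrow> real" where
  "B f g = (\<integral>w. f w * g w \<partial>M)"

lemma B_self: "B f f = (\<integral>w. (f w)\<^sup>2 \<partial>M)"
  by (simp add: B_def power2_eq_square)

lemma B_self_nonneg: "0 \<le> B f f"
  by (simp add: B_self)

lemma integrable_bcontfun_sq: "integrable M (\<lambda>w. (f w)\<^sup>2)" for f :: "'a \<Rightarrow>\<^sub>C real"
  using integrable_mult_bcontfun[of f f] by (simp add: power2_eq_square)

definition F :: "('a \<Rightarrow>\<^sub>C real) \<Rightarrow> 'a \<Rightarrow> real" where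
  "F f z = (\<integral>w. K z w * f w \<partial>M)"

lemma F_bound: "(F f z)\<^sup>2 \<le> k\<^sup>2 * measure M (space M) * B f f"
proof -
  have K2: "integrable M (\<lambda>w. (K z w)\<^sup>2)" "(K z w)\<^sup>2 \<le> k\<^sup>2" for w
  proof -
    show *: "(K z w)\<^sup>2 \<le> k\<^sup>2" for w
      using K_bound[of z w] k_nonneg by (intro abs_le_square_iff[THEN iffD1]) simp
    then show "integrable M (\<lambda>w. (K z w)\<^sup>2)"
      by (intro integrable_bounded[of _ "k\<^sup>2"]) auto
  qed
  have "(F f z)\<^sup>2 \<le> (\<integral>w. (K z w)\<^sup>2 \<partial>M) * B f f"
    unfolding F_def B_self
    by (rule Cauchy_Schwarz_integral) (use K2 integrable_bcontfun_sq in auto)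
  also have "(\<integral>w. (K z w)\<^sup>2 \<partial>M) \<le> (\<integral>w. k\<^sup>2 \<partial>M)"
    using K2 by (intro integral_mono) auto
  finally show ?thesis
    using B_self_nonneg[of f] by (simp add: mult_right_mono mult_ac)
qed

text \<open>Cauchy-Schwarz asks for the L^2 distance of two kernel rows, while the graphon
  assumption controls the L^1 distance. Boundedness bridges the two: the square of a difference is
  at most \<open>2 * k\<close> times its absolute value.\<close>

lemma F_modulus: "(F f z - F f z')\<^sup>2 \<le> 2 * k * (\<integral>w. \<bar>K z w - K z' w\<bar> \<partial>M) * B f f"
proof -
  have "F f z - F f z' = (\<integral>w. (K z w - K z' w) * f w \<partial>M)"
    by (simp add: F_def left_diff_distrib)
  then have "(F f z - F f z')\<^sup>2 \<le> (\<integral>w. (K z w - K z' w)\<^sup>2 \<partial>M) * B f f"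
    unfolding B_self
    by (simp, intro Cauchy_Schwarz_integral) (use integrable_K_diff_sq integrable_bcontfun_sq in auto)
  also have "(\<integral>w. (K z w - K z' w)\<^sup>2 \<partial>M) \<le> (\<integral>w. 2 * k * \<bar>K z w - K z' w\<bar> \<partial>M)"
  proof (intro integral_mono integrable_K_diff_sq)
    show "integrable M (\<lambda>w. 2 * k * \<bar>K z w - K z' w\<bar>)"
      using integrable_abs_K_diff by simp
    show "(K z w - K z' w)\<^sup>2 \<le> 2 * k * \<bar>K z w - K z' w\<bar>" for w
    proof -
      have "\<bar>K z w - K z' w\<bar> * \<bar>K z w - K z' w\<bar> \<le> 2 * k * \<bar>K z w - K z' w\<bar>"
        using K_bound[of z w] K_bound[of z' w] by (intro mult_right_mono) auto
      then show ?thesis by (simp add: power2_eq_square)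
    qed
  qed
  finally show ?thesis
    using B_self_nonneg[of f] by (simp add: mult_right_mono)
qed

lemma F_equicontinuous:
  assumes "0 < \<epsilon>" "0 < b"
  obtains \<delta> where "0 < \<delta>" "\<And>f z z'. B f f \<le> b \<Longrightarrow> dist z z' < \<delta> \<Longrightarrow> \<bar>F f z - F f z'\<bar> < \<epsilon>"
proof -
  \<comment> \<open>The summand 1 avoids a division by zero when \<open>k\<close> vanishes.\<close>
  have "0 < \<epsilon>\<^sup>2 / ((2 * k + 1) * b)"
    using assms k_nonneg by simp
  then obtain \<delta> where \<delta>: "0 < \<delta>"
    "\<And>z z'. dist z z' < \<delta> \<Longrightarrow> (\<integral>w. \<bar>K z w - K z' w\<bar> \<partial>M) < \<epsilon>\<^sup>2 / ((2 * k + 1) * b)"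
    using K_L1_continuous by meson
  have "\<bar>F f z - F f z'\<bar> < \<epsilon>" if "B f f \<le> b" "dist z z' < \<delta>" for f z z'
  proof -
    let ?I = "\<integral>w. \<bar>K z w - K z' w\<bar> \<partial>M"
    have I: "0 \<le> ?I" by simp
    have "(F f z - F f z')\<^sup>2 \<le> 2 * k * ?I * B f f"
      by (rule F_modulus)
    also have "\<dots> \<le> (2 * k + 1) * ?I * b"
      using I k_nonneg that B_self_nonneg by (intro mult_mono) auto
    also have "\<dots> = ?I * ((2 * k + 1) * b)"
      by simp
    also have "\<dots> < \<epsilon>\<^sup>2"
      using \<delta>(2)[OF that(2)] assms k_nonneg by (simp add: pos_less_divide_eq)
    finally have "\<bar>F f z - F f z'\<bar>\<^sup>2 < \<epsilon>\<^sup>2" by simp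
    then show ?thesis
      using assms(1) by (rule power2_less_imp_less[OF _ less_imp_le])
  qed
  then show thesis using \<delta>(1) that by blast
qed

lemma F_bcontfun: "F f \<in> bcontfun"
proof (rule bcontfun_normI)
  show "continuous_on UNIV (F f)"
    unfolding continuous_on_iff
  proof (intro ballI allI impI)
    fix z and e :: real assume "0 < e"
    then obtain \<delta> where "0 < \<delta>" "\<And>g z z'. B g g \<le> B f f + 1 \<Longrightarrow> dist z z' < \<delta> \<Longrightarrow> \<bar>F g z - F g z'\<bar> < e"
      using F_equicontinuous[OF \<open>0 < e\<close> add_nonneg_pos[OF B_self_nonneg[of f] zero_less_one]] by metis
    then show "\<exists>d>0. \<forall>z'\<in>UNIV. dist z' z < d \<longrightarrow> dist (F f z') (F f z) < e"
      by (intro exI[of _ \<delta>]) (auto simp: dist_real_def)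
  qed
  show "norm (F f z) \<le> sqrt (k\<^sup>2 * measure M (space M) * B f f)" for z
    using real_sqrt_le_mono[OF F_bound[of f z]] by simp
qed

definition T :: "('a \<Rightarrow>\<^sub>C real) \<Rightarrow> ('a \<Rightarrow>\<^sub>C real)" where
  "T f = Bcontfun (F f)"

lemma apply_T: "apply_bcontfun (T f) z = (\<integral>w. K z w * f w \<partial>M)"
  by (simp add: T_def Bcontfun_inverse[OF F_bcontfun] F_def)

lemma apply_T_F: "apply_bcontfun (T f) z = F f z"
  by (simp add: apply_T F_def)

lemma T_norm_sq: "(norm (T f))\<^sup>2 \<le> k\<^sup>2 * measure M (space M) * B f f"
proof -
  have "norm (T f) \<le> sqrt (k\<^sup>2 * measure M (space M) * B f f)"
  proof (rule norm_bound)
    show "norm (T f z) \<le> sqrt (k\<^sup>2 * measure M (space M) * B f f)" for z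
      using real_sqrt_le_mono[OF F_bound[of f z]] by (simp add: apply_T_F)
  qed
  then have "(norm (T f))\<^sup>2 \<le> (sqrt (k\<^sup>2 * measure M (space M) * B f f))\<^sup>2"
    by (rule power_mono) simp
  then show ?thesis
    using B_self_nonneg[of f] by simp
qed

lemma B_bound: "\<bar>B f g\<bar> \<le> norm f * norm g * measure M (space M)"
proof -
  have "\<bar>B f g\<bar> \<le> (\<integral>w. \<bar>f w * g w\<bar> \<partial>M)"
    unfolding B_def by (rule integral_abs_bound)
  also have "\<dots> \<le> (\<integral>w. norm f * norm g \<partial>M)"
  proof (rule integral_mono)
    show "integrable M (\<lambda>w. \<bar>f w * g w\<bar>)"
      by (rule integrable_abs) simp
  qed (auto simp: abs_mult intro!: mult_mono bcontfun_abs_le)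
  finally show ?thesis by (simp add: mult_ac)
qed

lemma bounded_linear_T: "bounded_linear T"
proof (rule bounded_linear_intro)
  show "T (f + g) = T f + T g" for f g
    by (rule bcontfun_eqI) (simp add: apply_T distrib_left)
  show "T (r *\<^sub>R f) = r *\<^sub>R T f" for r f
    by (rule bcontfun_eqI) (simp add: apply_T mult.left_commute[of _ r])
  show "norm (T f) \<le> norm f * (k * measure M (space M))" for f
  proof -
    have "(norm (T f))\<^sup>2 \<le> k\<^sup>2 * measure M (space M) * B f f"
      by (rule T_norm_sq)
    also have "\<dots> \<le> k\<^sup>2 * measure M (space M) * (norm f * norm f * measure M (space M))"
      using B_bound[of f f] by (intro mult_left_mono) auto
    also have "\<dots> = (norm f * (k * measure M (space M)))\<^sup>2"
      by (simp only: power2_eq_square mult_ac)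
    finally show ?thesis
      by (rule power2_le_imp_le) (simp add: k_nonneg)
  qed
qed

lemma bounded_bilinear_B: "bounded_bilinear B"
proof
  show "B (f + f') g = B f g + B f' g" for f f' g
    by (simp add: B_def distrib_right)
  show "B f (g + g') = B f g + B f g'" for f g g'
    by (simp add: B_def distrib_left)
  show "B (r *\<^sub>R f) g = r *\<^sub>R B f g" for r f g
    by (simp add: B_def mult.assoc)
  show "B f (r *\<^sub>R g) = r *\<^sub>R B f g" for r f g
    by (simp add: B_def mult.left_commute[of _ r])
  show "\<exists>c. \<forall>f g. norm (B f g) \<le> norm f * norm g * c"
    using B_bound by auto
qed

lemma T_symmetric: "B (T f) g = B f (T g)"
proof -
  interpret P: pair_sigma_finite M M
    by (intro pair_sigma_finite.intro sigma_finite_measure_axioms)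
  have sets_pair: "sets (M \<Otimes>\<^sub>M M) = sets (borel \<Otimes>\<^sub>M borel)"
    by (intro sets_pair_measure_cong sets_M)
  have meas: "(\<lambda>(z, w). K z w * f w * g z) \<in> borel_measurable (M \<Otimes>\<^sub>M M)"
    unfolding measurable_cong_sets[OF sets_pair refl] by measurable
  have int: "integrable (M \<Otimes>\<^sub>M M) (\<lambda>(z, w). K z w * f w * g z)"
  proof (rule finite_measure.integrable_const_bound[OF _ _ meas])
    show "finite_measure (M \<Otimes>\<^sub>M M)"
      by (rule finite_measure_pair_measure) (rule finite_measure_axioms)+
    show "AE x in M \<Otimes>\<^sub>M M. norm (case x of (z, w) \<Rightarrow> K z w * f w * g z) \<le> k * norm f * norm g"
    proof (rule AE_I2, clarify)
      show "norm (K z w * f w * g z) \<le> k * norm f * norm g" for z w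
        using k_nonneg by (auto simp: abs_mult intro!: mult_mono bcontfun_abs_le K_bound)
    qed
  qed
  have "B (T f) g = (\<integral>z. (\<integral>w. K z w * f w * g z \<partial>M) \<partial>M)"
    by (simp add: B_def apply_T)
  also have "\<dots> = (\<integral>w. (\<integral>z. K z w * f w * g z \<partial>M) \<partial>M)"
    using P.Fubini_integral[of "\<lambda>z w. K z w * f w * g z"] int by simp
  also have "\<dots> = (\<integral>w. (\<integral>z. f w * (K w z * g z) \<partial>M) \<partial>M)"
    using K_commute by (simp add: mult_ac)
  also have "\<dots> = B f (T g)"
    by (simp add: B_def apply_T)
  finally show ?thesis .
qed

lemma T_compact:
  fixes f :: "nat \<Rightarrow> 'a \<Rightarrow>\<^sub>C real"
  assumes f: "\<And>n. B (f n) (f n) \<le> 1"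
  shows "\<exists>(r::nat \<Rightarrow> nat) l. strict_mono r \<and> (\<lambda>n. T (f (r n))) \<longlonglongrightarrow> l"
proof -
  define h where "h n = apply_bcontfun (T (f n))" for n
  have bound: "norm (h n z) \<le> sqrt (k\<^sup>2 * measure M (space M))" for n z
  proof -
    have "(F (f n) z)\<^sup>2 \<le> k\<^sup>2 * measure M (space M) * 1"
      by (rule order_trans[OF F_bound mult_left_mono[OF f]]) simp
    from real_sqrt_le_mono[OF this] show ?thesis
      by (simp add: h_def apply_T_F)
  qed
  have equi: "\<exists>d. 0 < d \<and> (\<forall>n y. y \<in> S \<and> norm (x - y) < d \<longrightarrow> norm (h n x - h n y) < e)"
    if "0 < e" for x and e :: real
  proof -
    obtain \<delta> where "0 < \<delta>" "\<And>g z z'. B g g \<le> 1 \<Longrightarrow> dist z z' < \<delta> \<Longrightarrow> \<bar>F g z - F g z'\<bar> < e"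
      using F_equicontinuous[OF \<open>0 < e\<close> zero_less_one] by metis
    then show ?thesis
      using f by (intro exI[of _ \<delta>]) (auto simp: h_def apply_T_F dist_norm)
  qed
  obtain g and r :: "nat \<Rightarrow> nat" where r: "strict_mono r"
    and g: "\<And>e. 0 < e \<Longrightarrow> \<exists>N. \<forall>n x. n \<ge> N \<and> x \<in> S \<longrightarrow> norm (h (r n) x - g x) < e"
    by (rule Arzela_Ascoli[OF compact_S, of h "sqrt (k\<^sup>2 * measure M (space M))"])
      (use bound equi in \<open>auto\<close>)
  \<comment> \<open>The limit \<open>g\<close> is a bare function controlled on \<open>S\<close>
    only. It serves to show the Cauchy property, and completeness of the space of bounded continuous
    functions supplies the actual limit.\<close>
  have "Cauchy (\<lambda>n. T (f (r n)))"
  proof (rule metric_CauchyI)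
    fix e :: real assume "0 < e"
    then obtain N where N: "\<And>n x. n \<ge> N \<Longrightarrow> x \<in> S \<Longrightarrow> norm (h (r n) x - g x) < e / 4"
      using g[of "e / 4"] by auto
    have "dist (T (f (r m))) (T (f (r n))) < e" if "N \<le> m" "N \<le> n" for m n
    proof -
      have "dist (T (f (r m))) (T (f (r n))) \<le> e / 2"
      proof (rule dist_bound)
        fix z
        obtain z' where z': "z' \<in> S" "K z = K z'"
          using K_represented by blast
        have "dist (T (f (r m)) z) (T (f (r n)) z) = dist (h (r m) z') (h (r n) z')"
          by (simp add: h_def apply_T z'(2))
        also have "\<dots> \<le> dist (h (r m) z') (g z') + dist (h (r n) z') (g z')"
          by (rule dist_triangle2)
        also have "\<dots> \<le> e / 2"
          using N[OF that(1) z'(1)] N[OF that(2) z'(1)] by (simp add: dist_norm)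
        finally show "dist (T (f (r m)) z) (T (f (r n)) z) \<le> e / 2" .
      qed
      then show ?thesis using \<open>0 < e\<close> by simp
    qed
    then show "\<exists>N. \<forall>m\<ge>N. \<forall>n\<ge>N. dist (T (f (r m))) (T (f (r n))) < e"
      by blast
  qed
  then show ?thesis
    using r Cauchy_convergent convergent_def by blast
qed

lemma compact_symmetric_operator: "compact_symmetric_operator T B (k\<^sup>2 * measure M (space M))"
proof (rule compact_symmetric_operator.intro)
  show "B f g = B g f" for f g
    unfolding B_def by (subst mult.commute) (rule refl)
  show "bounded_linear T" by (rule bounded_linear_T)
  show "bounded_bilinear B" by (rule bounded_bilinear_B)
  show "0 \<le> B f f" for f by (rule B_self_nonneg)
  show "B (T f) g = B f (T g)" for f g by (rule T_symmetric)
  show "(norm (T f))\<^sup>2 \<le> k\<^sup>2 * measure M (space M) * B f f" for f by (rule T_norm_sq)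
  show "\<exists>(r::nat \<Rightarrow> nat) l. strict_mono r \<and> (\<lambda>n. T (f (r n))) \<longlonglongrightarrow> l"
    if "\<And>n. B (f n) (f n) \<le> 1" for f
    using that by (rule T_compact)
qed

sublocale compact_symmetric_operator T B "k\<^sup>2 * measure M (space M)"
  by (rule compact_symmetric_operator)

end

section \<open>Periodic functions and the strip\<close>

lemma periodic_real_obtains:
  assumes "0 < (p::real)"
  obtains k :: int where "0 \<le> x - of_int k * p" "x - of_int k * p < p"
proof (rule that[of "\<lfloor>x / p\<rfloor>"])
  show "0 \<le> x - of_int \<lfloor>x / p\<rfloor> * p"
    using floor_divide_lower[OF assms, of x] by simp
  show "x - of_int \<lfloor>x / p\<rfloor> * p < p"
    using floor_divide_upper[OF assms, of x] by (simp add: algebra_simps)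
qed

lemma periodic_shift_of_int:
  fixes f :: "real \<Rightarrow> 'b"
  assumes "\<And>u. f (u + p) = f u"
  shows "f (u + of_int k * p) = f u"
proof -
  have nat: "f (u + of_nat n * p) = f u" for n :: nat and u
  proof (induction n)
    case (Suc n)
    then show ?case
      using assms[of "u + of_nat n * p"] by (simp add: algebra_simps)
  qed simp
  show ?thesis
  proof (cases "0 \<le> k")
    case True
    then show ?thesis using nat[of u "nat k"] by simp
  next
    case False
    then show ?thesis using nat[of "u + of_int k * p" "nat (-k)"] by (simp add: algebra_simps)
  qed
qed

text \<open>After shifting by periods, the two points lie in an interval that crosses at most one
  end of a period; there the estimate is split, using that the function takes the same value at both
  ends.\<close>

lemma periodic_lipschitz:
  fixes f :: "real \<Rightarrow> real"
  assumes p: "0 < p" and per: "\<And>u. f (u + p) = f u" and lip: "C-lipschitz_on {0..p} f"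
  shows "\<bar>f a - f b\<bar> \<le> C * \<bar>a - b\<bar>"
proof -
  have C: "0 \<le> C" by (rule lipschitz_on_nonneg[OF lip])
  have base: "\<bar>f a - f b\<bar> \<le> C * (b - a)" if "0 \<le> a" "a \<le> b" "b \<le> p" for a b
    using lipschitz_onD[OF lip, of a b] that by (simp add: dist_real_def)
  have le: "\<bar>f a - f b\<bar> \<le> C * (b - a)" if "a \<le> b" for a b
  proof -
    obtain k :: int where k: "0 \<le> a - of_int k * p" "a - of_int k * p < p"
      by (rule periodic_real_obtains[OF p])
    obtain j :: int where j: "0 \<le> (b - a) - of_int j * p" "(b - a) - of_int j * p < p"
      by (rule periodic_real_obtains[OF p])
    \<comment> \<open>The gap is reduced by \<open>j\<close> whole periods, with \<open>j\<close>
      nonnegative, so it shrinks and ends up below \<open>p\<close>.\<close>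
    define a' where "a' = a - of_int k * p"
    define b' where "b' = b - of_int (k + j) * p"
    have "0 \<le> of_int j * p"
    proof -
      have "-1 * p < of_int j * p" using j(2) that by linarith
      then have "-1 < real_of_int j" using p by (simp only: mult_less_cancel_right_pos)
      then show ?thesis using p by (intro mult_nonneg_nonneg) auto
    qed
    then have d: "b' - a' \<le> b - a" "a' \<le> b'" "0 \<le> a'" "a' < p" "b' < a' + p"
      using j k by (auto simp: a'_def b'_def algebra_simps)
    have "f a = f a'" "f b = f b'"
      using periodic_shift_of_int[of f p, OF per, of a' k] periodic_shift_of_int[of f p, OF per, of b' "k + j"]
      by (simp_all add: a'_def b'_def)
    moreover have "\<bar>f a' - f b'\<bar> \<le> C * (b' - a')"
    proof (cases "b' \<le> p")
      case True
      then show ?thesis using base d by simp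
    next
      case False
      have "\<bar>f a' - f p\<bar> \<le> C * (p - a')"
        using d by (intro base) auto
      moreover have "\<bar>f 0 - f (b' - p)\<bar> \<le> C * (b' - p - 0)"
        using d False by (intro base) auto
      moreover have "f p = f 0" "f (b' - p) = f b'"
        using per[of 0] per[of "b' - p"] by simp_all
      ultimately show ?thesis by (simp add: algebra_simps)
    qed
    moreover have "C * (b' - a') \<le> C * (b - a)"
      using d C by (intro mult_left_mono)
    ultimately show ?thesis by linarith
  qed
  show ?thesis
    using le[of a b] le[of b a] by (cases "a \<le> b") (auto simp: abs_minus_commute)
qed

lemma set_integral_reflect:
  fixes f :: "real \<Rightarrow> real"
  shows "(LBINT v:{0..p}. f (p - v)) = (LBINT v:{0..p}. f v)"
proof -
  have "(LBINT v:{0..p}. f v) = (\<integral>v. indicator {0..p} (p + (-1) * v) *\<^sub>R f (p + (-1) * v) \<partial>lborel)"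
    unfolding set_lebesgue_integral_def
    by (subst lborel_integral_real_affine[where c="-1" and t=p]) simp_all
  also have "\<dots> = (LBINT v:{0..p}. f (p - v))"
    unfolding set_lebesgue_integral_def
    by (intro Bochner_Integration.integral_cong) (auto simp: indicator_def)
  finally show ?thesis by simp
qed

lemma periodic_integral_reflect:
  fixes f :: "real \<Rightarrow> real"
  assumes "\<And>v. f (v + p) = f v"
  shows "(LBINT v:{0..p}. f (- v)) = (LBINT v:{0..p}. f v)"
proof -
  have "f (- v) = f (p - v)" for v
    using assms[of "- v"] by (simp add: add.commute)
  then show ?thesis
    by (simp only: set_integral_reflect)
qed

text \<open>The shift may be reduced to \<open>t\<close> within one period; the piece of the
  integral that leaves at the right end re-enters at the left.\<close>

lemma periodic_integral_shift:
  fixes f :: "real \<Rightarrow> real"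
  assumes p: "0 < p" and per: "\<And>v. f (v + p) = f v" and cont: "continuous_on UNIV f"
  shows "(LBINT v:{0..p}. f (v + u)) = (LBINT v:{0..p}. f v)"
proof -
  have int: "set_integrable lborel {a..b} f" for a b
    by (rule borel_integrable_atLeastAtMost') (rule continuous_on_subset[OF cont], simp)
  have translate: "(LBINT v:{a..b}. f (v + t)) = (LBINT v:{a+t..b+t}. f v)" for a b t
  proof -
    have "(LBINT v:{a+t..b+t}. f v) = (\<integral>v. indicator {a+t..b+t} (t + 1 * v) *\<^sub>R f (t + 1 * v) \<partial>lborel)"
      unfolding set_lebesgue_integral_def
      by (subst lborel_integral_real_affine[where c=1 and t=t]) simp_all
    also have "\<dots> = (LBINT v:{a..b}. f (v + t))"
      unfolding set_lebesgue_integral_def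
      by (intro Bochner_Integration.integral_cong) (auto simp: indicator_def add.commute)
    finally show ?thesis by simp
  qed
  have split: "(LBINT v:{a..c}. f v) = (LBINT v:{a..b}. f v) + (LBINT v:{b..c}. f v)"
    if "a \<le> b" "b \<le> c" for a b c
  proof -
    have "(LBINT v:{a..c}. f v) = (LBINT v:{a..b} \<union> {b..c}. f v)"
      using that by (simp add: ivl_disj_un_two_touch)
    also have "\<dots> = (LBINT v:{a..b}. f v) + (LBINT v:{b..c}. f v)"
    proof (rule set_integral_Un_AE)
      show "AE v in lborel. \<not> (v \<in> {a..b} \<and> v \<in> {b..c})"
        using AE_lborel_singleton[of b] by eventually_elim auto
    qed (use int in auto)
    finally show ?thesis .
  qed
  obtain k :: int where k: "0 \<le> u - of_int k * p" "u - of_int k * p < p"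
    by (rule periodic_real_obtains[OF p])
  define t where "t = u - of_int k * p"
  have "f (v + u) = f (v + t)" for v
    using periodic_shift_of_int[of f p, OF per, of "v + t" k] by (simp add: t_def algebra_simps)
  then have "(LBINT v:{0..p}. f (v + u)) = (LBINT v:{0+t..p+t}. f v)"
    by (simp only: translate)
  also have "\<dots> = (LBINT v:{t..p}. f v) + (LBINT v:{p..p+t}. f v)"
    using split[of t p "p + t"] k by (simp add: t_def)
  also have "(LBINT v:{p..p+t}. f v) = (LBINT v:{0+p..t+p}. f v)"
    by (simp add: add.commute)
  also have "\<dots> = (LBINT v:{0..t}. f (v + p))"
    by (simp only: translate)
  also have "\<dots> = (LBINT v:{0..t}. f v)"
    by (simp only: per)
  also have "(LBINT v:{t..p}. f v) + (LBINT v:{0..t}. f v) = (LBINT v:{0..p}. f v)"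
    using split[of 0 t p] k by (simp add: t_def)
  finally show ?thesis .
qed

text \<open>The retraction of the line onto the unit interval. It extends the graphon to the plane
  with the same values, and being 1-Lipschitz it preserves the L^1 continuity.\<close>

definition unit_clamp :: "real \<Rightarrow> real" where "unit_clamp x = max 0 (min 1 x)"

lemma unit_clamp_bounds [simp]: "0 \<le> unit_clamp x" "unit_clamp x \<le> 1"
  by (auto simp: unit_clamp_def)

lemma unit_clamp_id [simp]: "0 \<le> x \<Longrightarrow> x \<le> 1 \<Longrightarrow> unit_clamp x = x"
  by (auto simp: unit_clamp_def)

lemma unit_clamp_lipschitz: "\<bar>unit_clamp x - unit_clamp y\<bar> \<le> \<bar>x - y\<bar>"
  by (auto simp: unit_clamp_def)

lemma continuous_on_unit_clamp [continuous_intros]: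
  "continuous_on A f \<Longrightarrow> continuous_on A (\<lambda>x. unit_clamp (f x))"
  unfolding unit_clamp_def by (intro continuous_intros)

lemma unit_clamp_measurable [measurable]: "unit_clamp \<in> borel_measurable borel"
  by (intro borel_measurable_continuous_onI continuous_intros)

lemma measurable_snd_borel [measurable]: "snd \<in> borel_measurable (borel :: (real \<times> real) measure)"
  and measurable_fst_borel [measurable]: "fst \<in> borel_measurable (borel :: (real \<times> real) measure)"
  unfolding borel_prod[symmetric] by measurable

text \<open>Lebesgue measure of the strip, kept as a finite measure on the whole plane so that all
  functions share one domain, on which shifts and reflections in u make sense.\<close>

definition strip_measure :: "(real \<times> real) measure" where
  "strip_measure = density lborel (\<lambda>z. ennreal (indicator strip z))"

lemma strip_cbox: "strip = cbox (0, 0) (2 * pi, 1)"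
  by (auto simp: strip_def cbox_Pair_eq)

lemma strip_borel [measurable]: "strip \<in> sets borel"
  by (simp add: strip_cbox)

lemma sets_strip_measure: "sets strip_measure = sets borel"
  by (simp add: strip_measure_def)

lemma finite_strip_measure: "finite_measure strip_measure"
proof (rule finite_measureI)
  have "emeasure strip_measure (space strip_measure) = (\<integral>\<^sup>+z. indicator strip z \<partial>lborel)"
    by (simp add: strip_measure_def emeasure_density ennreal_indicator)
  also have "\<dots> = emeasure lborel strip"
    by simp
  also have "\<dots> < \<infinity>"
    unfolding strip_cbox by (rule emeasure_lborel_cbox_finite)
  finally show "emeasure strip_measure (space strip_measure) \<noteq> \<infinity>" by simp
qed

lemma integral_strip_measure:
  fixes f :: "real \<times> real \<Rightarrow> real"
  assumes [measurable]: "f \<in> borel_measurable borel"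
  shows "(\<integral>z. f z \<partial>strip_measure) = (LINT z:strip|lborel. f z)"
    and "integrable strip_measure f \<longleftrightarrow> set_integrable lborel strip f"
  unfolding strip_measure_def set_lebesgue_integral_def set_integrable_def
  by (subst integral_density integrable_density; simp)+

lemma bounded_set_integrable_strip:
  fixes f :: "real \<times> real \<Rightarrow> real"
  assumes [measurable]: "f \<in> borel_measurable borel" and "\<And>z. \<bar>f z\<bar> \<le> c"
  shows "set_integrable lborel strip f"
proof -
  interpret finite_measure strip_measure by (rule finite_strip_measure)
  have "f \<in> borel_measurable strip_measure"
    using assms(1) by (simp add: measurable_cong_sets[OF sets_strip_measure refl])
  then have "integrable strip_measure f"
    by (intro integrable_const_bound[of _ c]) (use assms(2) in auto)
  then show ?thesis
    by (simp add: integral_strip_measure)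
qed

lemma integral_strip_measure_iterated:
  fixes f :: "real \<times> real \<Rightarrow> real"
  assumes [measurable]: "f \<in> borel_measurable borel" and "\<And>z. \<bar>f z\<bar> \<le> c"
  shows "(\<integral>z. f z \<partial>strip_measure) = (LBINT y:{0..1}. LBINT v:{0..2 * pi}. f (v, y))"
proof -
  have int: "integrable (lborel \<Otimes>\<^sub>M lborel) (\<lambda>(v, y). indicator strip (v, y) *\<^sub>R f (v, y))"
    using bounded_set_integrable_strip[OF assms] unfolding set_integrable_def lborel_prod
    by (simp add: case_prod_beta')
  have "(\<integral>z. f z \<partial>strip_measure) = (\<integral>z. indicator strip z *\<^sub>R f z \<partial>lborel)"
    by (simp add: integral_strip_measure set_lebesgue_integral_def)
  also have "\<dots> = (\<integral>z. (case z of (v, y) \<Rightarrow> indicator strip (v, y) *\<^sub>R f (v, y)) \<partial>(lborel \<Otimes>\<^sub>M lborel))"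
    by (simp add: lborel_prod case_prod_beta')
  also have "\<dots> = (\<integral>y. (\<integral>v. indicator strip (v, y) *\<^sub>R f (v, y) \<partial>lborel) \<partial>lborel)"
    by (rule lborel_pair.integral_snd[OF int, symmetric])
  also have "\<dots> = (LBINT y:{0..1}. LBINT v:{0..2 * pi}. f (v, y))"
  proof -
    have eq: "indicator strip (v, y) *\<^sub>R f (v, y) = indicator {0..1} y *\<^sub>R (indicator {0..2 * pi} v *\<^sub>R f (v, y))"
      for v y :: real
      by (auto simp: indicator_def strip_def)
    show ?thesis
      unfolding set_lebesgue_integral_def by (simp only: eq) simp
  qed
  finally show ?thesis .
qed

section \<open>The linearised mean-field operator\<close>

lemma abs_mean_le:
  fixes a b c :: real
  shows "\<bar>a\<bar> \<le> c \<Longrightarrow> \<bar>b\<bar> \<le> c \<Longrightarrow> \<bar>(a + b) / 2\<bar> \<le> c"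
  by (simp add: abs_le_iff)

locale mean_field_model =
  fixes W :: "real \<Rightarrow> real \<Rightarrow> real" and D :: "real \<Rightarrow> real" and \<beta> :: real
  assumes graphon: "graphon W"
    and potential: "interaction_potential D"
    and \<beta>_pos: "0 < \<beta>"
begin

lemma D_even: "D (- u) = D u" and D_periodic: "D (u + 2 * pi) = D u"
  using potential by (auto simp: interaction_potential_def)

definition D_lip :: real where
  "D_lip = (SOME C. \<forall>a b. \<bar>D a - D b\<bar> \<le> C * \<bar>a - b\<bar>)"

lemma D_lipschitz: "\<bar>D a - D b\<bar> \<le> D_lip * \<bar>a - b\<bar>"
proof -
  obtain C where "C-lipschitz_on {0..2 * pi} D"
    using potential by (auto simp: interaction_potential_def)
  then have "\<exists>C. \<forall>a b. \<bar>D a - D b\<bar> \<le> C * \<bar>a - b\<bar>"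
    using periodic_lipschitz[of "2 * pi" D, OF _ D_periodic] by auto
  from someI_ex[OF this] show ?thesis
    by (simp add: D_lip_def)
qed

lemma D_lip_nonneg: "0 \<le> D_lip"
  using D_lipschitz[of 1 0] by simp

lemma continuous_on_D [continuous_intros]:
  assumes "continuous_on A f"
  shows "continuous_on A (\<lambda>x. D (f x))"
proof -
  have "D_lip-lipschitz_on UNIV D"
    by (rule lipschitz_onI) (use D_lipschitz D_lip_nonneg in \<open>auto simp: dist_real_def\<close>)
  then have "continuous_on UNIV D"
    by (rule lipschitz_on_continuous_on)
  from continuous_on_compose2[OF this assms] show ?thesis by simp
qed

lemma D_measurable [measurable]: "D \<in> borel_measurable borel"
  by (intro borel_measurable_continuous_onI continuous_intros)

definition D_bound :: real where "D_bound = \<bar>D 0\<bar> + D_lip * (2 * pi)"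

lemma abs_D_le: "\<bar>D u\<bar> \<le> D_bound"
proof -
  obtain k :: int where k: "0 \<le> u - of_int k * (2 * pi)" "u - of_int k * (2 * pi) < 2 * pi"
    by (rule periodic_real_obtains[of "2 * pi"]) auto
  define t where "t = u - of_int k * (2 * pi)"
  have "D u = D t"
    using periodic_shift_of_int[of D "2 * pi", OF D_periodic, of t k] by (simp add: t_def)
  moreover have "\<bar>D t - D 0\<bar> \<le> D_lip * (2 * pi)"
    using D_lipschitz[of t 0] mult_left_mono[OF _ D_lip_nonneg, of t "2 * pi"] k
    by (simp add: t_def)
  ultimately show ?thesis
    unfolding D_bound_def by linarith
qed

lemma D_bound_nonneg: "0 \<le> D_bound"
  using abs_D_le[of 0] by linarith

definition D_mean :: real where "D_mean = (LBINT v:{0..2 * pi}. D v) / (2 * pi)"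

definition Wc :: "real \<Rightarrow> real \<Rightarrow> real" where "Wc x y = W (unit_clamp x) (unit_clamp y)"

lemma W_range: "0 \<le> W x y" "W x y \<le> 1" and W_commute: "W x y = W y x"
  if "x \<in> {0..1}" "y \<in> {0..1}"
  using graphon that by (auto simp: graphon_def)

lemma Wc_range: "0 \<le> Wc x y" "Wc x y \<le> 1" and Wc_commute: "Wc x y = Wc y x"
  unfolding Wc_def by (rule W_range W_commute; simp)+

lemma Wc_eq: "x \<in> {0..1} \<Longrightarrow> y \<in> {0..1} \<Longrightarrow> Wc x y = W x y"
  by (simp add: Wc_def)

lemma Wc_measurable [measurable]:
  assumes [measurable]: "f \<in> borel_measurable N" "g \<in> borel_measurable N"
  shows "(\<lambda>x. Wc (f x) (g x)) \<in> borel_measurable N"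
proof -
  have "(\<lambda>p. indicator ({0..1} \<times> {0..1}) p *\<^sub>R (case p of (x, y) \<Rightarrow> W x y)) \<in> borel_measurable borel"
    using graphon by (auto simp: graphon_def set_borel_measurable_def)
  moreover have "(\<lambda>x. (unit_clamp (f x), unit_clamp (g x))) \<in> N \<rightarrow>\<^sub>M borel"
    unfolding borel_prod[symmetric] by measurable
  ultimately have "(\<lambda>x. indicator ({0..1} \<times> {0..1}) (unit_clamp (f x), unit_clamp (g x)) *\<^sub>R
      (case (unit_clamp (f x), unit_clamp (g x)) of (x, y) \<Rightarrow> W x y)) \<in> borel_measurable N"
    by (rule measurable_compose[rotated])
  then show ?thesis
    by (simp add: Wc_def)
qed

lemma Wc_L1_continuous:
  assumes "0 < \<epsilon>"
  obtains \<delta> where "0 < \<delta>" "\<And>x x'. \<bar>x - x'\<bar> < \<delta> \<Longrightarrow> (LBINT y:{0..1}. \<bar>Wc x y - Wc x' y\<bar>) < \<epsilon>"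
proof -
  obtain \<delta> where \<delta>: "0 < \<delta>" "\<forall>x1\<in>{0..1}. \<forall>x2\<in>{0..1}. \<bar>x1 - x2\<bar> < \<delta> \<longrightarrow>
        (LBINT y:{0..1}. \<bar>W x1 y - W x2 y\<bar>) < \<epsilon>"
    using graphon assms unfolding graphon_def by blast
  have "(LBINT y:{0..1}. \<bar>Wc x y - Wc x' y\<bar>) < \<epsilon>" if "\<bar>x - x'\<bar> < \<delta>" for x x'
  proof -
    have "(LBINT y:{0..1}. \<bar>Wc x y - Wc x' y\<bar>)
        = (LBINT y:{0..1}. \<bar>W (unit_clamp x) y - W (unit_clamp x') y\<bar>)"
      by (rule set_lebesgue_integral_cong) (auto simp: Wc_def)
    also have "\<dots> < \<epsilon>"
      using \<delta>(2) unit_clamp_lipschitz[of x x'] that by simp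
    finally show ?thesis .
  qed
  with \<delta>(1) show thesis by (rule that)
qed

text \<open>The kernel of \<open>T\<close>, symmetrised in \<open>u\<close> and with the zeroth Fourier mode of \<open>D\<close> removed.
  It agrees with the original kernel on functions that are even with mean zero in \<open>u\<close>, and
  its integral operator maps every function to such a one.\<close>
definition kernel :: "real \<times> real \<Rightarrow> real \<times> real \<Rightarrow> real" where
  "kernel z w = - (\<beta> / (2 * pi)) *
     (Wc (snd z) (snd w) * ((D (fst z - fst w) + D (fst z + fst w)) / 2 - D_mean))"

definition kernel_bound :: real where
  "kernel_bound = \<beta> / (2 * pi) * (D_bound + \<bar>D_mean\<bar>)"

lemma abs_D_part_le: "\<bar>(D (u - v) + D (u + v)) / 2 - D_mean\<bar> \<le> D_bound + \<bar>D_mean\<bar>"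
proof -
  have "\<bar>(D (u - v) + D (u + v)) / 2\<bar> \<le> D_bound"
    by (intro abs_mean_le abs_D_le)
  then show ?thesis
    using abs_triangle_ineq4[of "(D (u - v) + D (u + v)) / 2" D_mean] by linarith
qed

lemma kernel_le: "\<bar>kernel z w\<bar> \<le> kernel_bound"
proof -
  have "\<bar>kernel z w\<bar> = \<beta> / (2 * pi) *
      (Wc (snd z) (snd w) * \<bar>(D (fst z - fst w) + D (fst z + fst w)) / 2 - D_mean\<bar>)"
    using \<beta>_pos Wc_range by (simp add: kernel_def abs_mult)
  also have "\<dots> \<le> \<beta> / (2 * pi) * (1 * (D_bound + \<bar>D_mean\<bar>))"
    using \<beta>_pos Wc_range abs_D_part_le by (intro mult_left_mono mult_mono) auto
  finally show ?thesis by (simp add: kernel_bound_def)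
qed

lemma kernel_commute: "kernel z w = kernel w z"
  using D_even[of "fst z - fst w"]
  by (simp add: kernel_def Wc_commute[of "snd z"] add.commute)

lemma kernel_measurable [measurable]:
  assumes [measurable]: "f \<in> borel_measurable N" "g \<in> borel_measurable N"
  shows "(\<lambda>x. kernel (f x) (g x)) \<in> borel_measurable N"
proof -
  have [measurable]: "(\<lambda>x. fst (f x)) \<in> borel_measurable N" "(\<lambda>x. snd (f x)) \<in> borel_measurable N"
    "(\<lambda>x. fst (g x)) \<in> borel_measurable N" "(\<lambda>x. snd (g x)) \<in> borel_measurable N"
    using assms unfolding borel_prod[symmetric] by measurable
  show ?thesis unfolding kernel_def by measurable
qed

lemma kernel_periodic: "kernel (u + 2 * pi, x) = kernel (u, x)"
proof
  fix w :: "real \<times> real"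
  have "D (u + 2 * pi - fst w) = D (u - fst w)" "D (u + 2 * pi + fst w) = D (u + fst w)"
    using D_periodic[of "u - fst w"] D_periodic[of "u + fst w"] by (simp_all add: algebra_simps)
  then show "kernel (u + 2 * pi, x) w = kernel (u, x) w"
    by (simp add: kernel_def)
qed

lemma kernel_even: "kernel (- u, x) = kernel (u, x)"
proof
  fix w
  show "kernel (- u, x) w = kernel (u, x) w"
    using D_even[of "u - fst w"] D_even[of "u + fst w"] by (simp add: kernel_def algebra_simps)
qed

lemma kernel_clamp: "kernel (u, unit_clamp x) = kernel (u, x)"
  by (simp add: kernel_def Wc_def fun_eq_iff)

text \<open>The kernel is a product of a graphon factor and a potential factor. Its variation splits
  into that of the graphon times a bounded function, small in L^1, and a bounded graphon value times
  that of the Lipschitz potential.\<close>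

lemma kernel_L1_continuous:
  assumes "0 < \<epsilon>"
  shows "\<exists>\<delta>>0. \<forall>z z'. dist z z' < \<delta> \<longrightarrow> (\<integral>w. \<bar>kernel z w - kernel z' w\<bar> \<partial>strip_measure) < \<epsilon>"
proof -
  interpret finite_measure strip_measure by (rule finite_strip_measure)
  let ?m = "measure strip_measure (space strip_measure)"
  define b where "b = \<beta> / (2 * pi) * D_lip"
  have b: "0 \<le> b" using \<beta>_pos D_lip_nonneg by (simp add: b_def)
  have kb: "0 \<le> kernel_bound" using kernel_le[of undefined undefined] by linarith
  have meas: "measurable strip_measure N = measurable borel N" for N :: "real measure"
    by (rule measurable_cong_sets) (simp_all add: sets_strip_measure)
  have bdd: "integrable strip_measure f" if "f \<in> borel_measurable borel" "\<And>w. \<bar>f w\<bar> \<le> c" for f :: "real \<times> real \<Rightarrow> real" and c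
    by (rule integrable_const_bound[of _ c]) (use that in \<open>auto simp: meas\<close>)
  have pointwise: "\<bar>kernel z w - kernel z' w\<bar>
      \<le> kernel_bound * \<bar>Wc (snd z) (snd w) - Wc (snd z') (snd w)\<bar> + b * \<bar>fst z - fst z'\<bar>" for z z' w
  proof -
    define d where "d u = (D (u - fst w) + D (u + fst w)) / 2 - D_mean" for u
    have kd: "kernel z w = - (\<beta> / (2 * pi)) * (Wc (snd z) (snd w) * d (fst z))" for z
      by (simp add: kernel_def d_def)
    have "kernel z w - kernel z' w = - (\<beta> / (2 * pi)) *
        ((Wc (snd z) (snd w) - Wc (snd z') (snd w)) * d (fst z) + Wc (snd z') (snd w) * (d (fst z) - d (fst z')))"
      unfolding kd by (simp add: algebra_simps)
    then have "\<bar>kernel z w - kernel z' w\<bar> = \<beta> / (2 * pi) *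
        \<bar>(Wc (snd z) (snd w) - Wc (snd z') (snd w)) * d (fst z) + Wc (snd z') (snd w) * (d (fst z) - d (fst z'))\<bar>"
      using \<beta>_pos by (simp add: abs_mult)
    also have "\<dots> \<le> \<beta> / (2 * pi) *
        (\<bar>Wc (snd z) (snd w) - Wc (snd z') (snd w)\<bar> * (D_bound + \<bar>D_mean\<bar>) + 1 * (D_lip * \<bar>fst z - fst z'\<bar>))"
    proof (intro mult_left_mono order_trans[OF abs_triangle_ineq] add_mono)
      show "\<bar>(Wc (snd z) (snd w) - Wc (snd z') (snd w)) * d (fst z)\<bar>
          \<le> \<bar>Wc (snd z) (snd w) - Wc (snd z') (snd w)\<bar> * (D_bound + \<bar>D_mean\<bar>)"
        unfolding abs_mult d_def by (intro mult_left_mono abs_D_part_le) simp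
      have "\<bar>d (fst z) - d (fst z')\<bar> \<le> D_lip * \<bar>fst z - fst z'\<bar>"
        using D_lipschitz[of "fst z - fst w" "fst z' - fst w"] D_lipschitz[of "fst z + fst w" "fst z' + fst w"]
          abs_mean_le[of "D (fst z - fst w) - D (fst z' - fst w)" "D_lip * \<bar>fst z - fst z'\<bar>"
            "D (fst z + fst w) - D (fst z' + fst w)"]
        by (simp add: d_def diff_divide_distrib add_divide_distrib)
      then show "\<bar>Wc (snd z') (snd w) * (d (fst z) - d (fst z'))\<bar> \<le> 1 * (D_lip * \<bar>fst z - fst z'\<bar>)"
        unfolding abs_mult using Wc_range by (intro mult_mono) auto
    qed (use \<beta>_pos in auto)
    also have "\<dots> = kernel_bound * \<bar>Wc (snd z) (snd w) - Wc (snd z') (snd w)\<bar> + b * \<bar>fst z - fst z'\<bar>"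
      by (simp add: kernel_bound_def b_def algebra_simps add_divide_distrib)
    finally show ?thesis .
  qed
  have Wabs: "\<bar>\<bar>Wc x y - Wc x' y\<bar>\<bar> \<le> 1" for x x' y
    using Wc_range[of x y] Wc_range[of x' y] by linarith
  have intW: "integrable strip_measure (\<lambda>w. \<bar>Wc x (snd w) - Wc x' (snd w)\<bar>)" for x x'
    by (rule bdd[OF _ Wabs]) measurable
  have W: "(\<integral>w. \<bar>Wc x (snd w) - Wc x' (snd w)\<bar> \<partial>strip_measure)
      = 2 * pi * (LBINT y:{0..1}. \<bar>Wc x y - Wc x' y\<bar>)" for x x'
  proof -
    have "(\<integral>w. \<bar>Wc x (snd w) - Wc x' (snd w)\<bar> \<partial>strip_measure)
        = (LBINT y:{0..1}. LBINT v:{0..2 * pi}. \<bar>Wc x y - Wc x' y\<bar>)"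
      using integral_strip_measure_iterated[of "\<lambda>w. \<bar>Wc x (snd w) - Wc x' (snd w)\<bar>", OF _ Wabs]
      by simp
    also have "\<dots> = (LBINT y:{0..1}. 2 * pi * \<bar>Wc x y - Wc x' y\<bar>)"
      by (simp add: set_lebesgue_integral_def)
    finally show ?thesis by simp
  qed
  have le: "(\<integral>w. \<bar>kernel z w - kernel z' w\<bar> \<partial>strip_measure)
      \<le> kernel_bound * (2 * pi) * (LBINT y:{0..1}. \<bar>Wc (snd z) y - Wc (snd z') y\<bar>) + b * ?m * \<bar>fst z - fst z'\<bar>"
    for z z'
  proof -
    have "(\<integral>w. \<bar>kernel z w - kernel z' w\<bar> \<partial>strip_measure)
        \<le> (\<integral>w. kernel_bound * \<bar>Wc (snd z) (snd w) - Wc (snd z') (snd w)\<bar> + b * \<bar>fst z - fst z'\<bar> \<partial>strip_measure)"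
    proof (intro integral_mono pointwise)
      show "integrable strip_measure (\<lambda>w. \<bar>kernel z w - kernel z' w\<bar>)"
      proof (rule bdd)
        show "\<bar>\<bar>kernel z w - kernel z' w\<bar>\<bar> \<le> 2 * kernel_bound" for w
          using kernel_le[of z w] kernel_le[of z' w] by linarith
      qed measurable
      show "integrable strip_measure
          (\<lambda>w. kernel_bound * \<bar>Wc (snd z) (snd w) - Wc (snd z') (snd w)\<bar> + b * \<bar>fst z - fst z'\<bar>)"
        using intW by simp
    qed
    also have "\<dots> = kernel_bound * (\<integral>w. \<bar>Wc (snd z) (snd w) - Wc (snd z') (snd w)\<bar> \<partial>strip_measure)
        + b * ?m * \<bar>fst z - fst z'\<bar>"
      using intW by simp
    finally show ?thesis by (simp only: W mult_ac)
  qed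
  define A where "A = kernel_bound * (2 * pi) + 1"
  have A: "0 < A" using kb by (simp add: A_def add_nonneg_pos)
  obtain \<delta> where \<delta>: "0 < \<delta>"
    "\<And>x x'. \<bar>x - x'\<bar> < \<delta> \<Longrightarrow> (LBINT y:{0..1}. \<bar>Wc x y - Wc x' y\<bar>) < \<epsilon> / (2 * A)"
    using Wc_L1_continuous[of "\<epsilon> / (2 * A)"] A assms by auto
  define E where "E = b * ?m + 1"
  have E: "0 < E" using b by (simp add: E_def add_nonneg_pos)
  have "(\<integral>w. \<bar>kernel z w - kernel z' w\<bar> \<partial>strip_measure) < \<epsilon>"
    if "dist z z' < min \<delta> (\<epsilon> / (2 * E))" for z z'
  proof -
    let ?I = "LBINT y:{0..1}. \<bar>Wc (snd z) y - Wc (snd z') y\<bar>"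
    have d: "\<bar>snd z - snd z'\<bar> < \<delta>" "\<bar>fst z - fst z'\<bar> < \<epsilon> / (2 * E)"
      using that dist_fst_le[of z z'] dist_snd_le[of z z'] by (auto simp: dist_real_def)
    have I: "0 \<le> ?I"
      by (simp add: set_lebesgue_integral_def)
    have "kernel_bound * (2 * pi) * ?I \<le> A * ?I"
      using I by (intro mult_right_mono) (auto simp: A_def)
    also have "\<dots> < \<epsilon> / 2"
      using \<delta>(2)[OF d(1)] A by (simp add: field_simps)
    finally have 1: "kernel_bound * (2 * pi) * ?I < \<epsilon> / 2" .
    have "b * ?m * \<bar>fst z - fst z'\<bar> \<le> E * \<bar>fst z - fst z'\<bar>"
      by (intro mult_right_mono) (auto simp: E_def)
    also have "\<dots> < \<epsilon> / 2"
      using d(2) E by (simp add: field_simps)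
    finally show ?thesis
      using 1 le[of z z'] by linarith
  qed
  then show ?thesis
    using \<delta>(1) assms E by (intro exI[of _ "min \<delta> (\<epsilon> / (2 * E))"]) simp
qed

lemma kernel_represented: "\<exists>z'\<in>strip. kernel z = kernel z'"
proof -
  obtain u x where z: "z = (u, x)" by fastforce
  obtain k :: int where k: "0 \<le> u - of_int k * (2 * pi)" "u - of_int k * (2 * pi) < 2 * pi"
    by (rule periodic_real_obtains[of "2 * pi"]) auto
  define t where "t = u - of_int k * (2 * pi)"
  have "kernel (u, x) = kernel (t, x)"
    using periodic_shift_of_int[of "\<lambda>u. kernel (u, x)" "2 * pi", OF kernel_periodic, of t k]
    by (simp add: t_def)
  then have "kernel z = kernel (t, unit_clamp x)"
    by (simp add: z kernel_clamp)
  moreover have "(t, unit_clamp x) \<in> strip"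
    using k by (simp add: strip_def t_def)
  ultimately show ?thesis by blast
qed

sublocale symmetric_integral_operator strip_measure strip kernel kernel_bound
proof (intro symmetric_integral_operator.intro symmetric_integral_operator_axioms.intro)
  show "finite_measure strip_measure" by (rule finite_strip_measure)
  show "sets strip_measure = sets borel" by (rule sets_strip_measure)
  show "compact strip" by (simp add: strip_cbox)
  show "(\<lambda>(z, w). kernel z w) \<in> borel_measurable (borel \<Otimes>\<^sub>M borel)" by measurable
  show "\<bar>kernel z w\<bar> \<le> kernel_bound" for z w by (rule kernel_le)
  show "kernel z w = kernel w z" for z w by (rule kernel_commute)
  show "\<exists>\<delta>>0. \<forall>z z'. dist z z' < \<delta> \<longrightarrow> (\<integral>w. \<bar>kernel z w - kernel z' w\<bar> \<partial>strip_measure) < \<epsilon>"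
    if "0 < \<epsilon>" for \<epsilon> using that by (rule kernel_L1_continuous)
  show "\<exists>z'\<in>strip. kernel z = kernel z'" for z by (rule kernel_represented)
qed

end

lemma set_integrable_continuous_interval [simp]:
  fixes f :: "real \<Rightarrow> real"
  shows "continuous_on UNIV f \<Longrightarrow> set_integrable lborel {a..b} f"
  by (rule borel_integrable_atLeastAtMost') (rule continuous_on_subset, auto)

lemma set_integral_const_interval: "(LBINT v:{0..2 * pi}. (c :: real)) = 2 * pi * c"
  by (simp add: set_lebesgue_integral_def)

section \<open>Fibre means, and the comparison of \<open>T\<close> with the original operator
  \<open>T_op\<close>\<close>

context mean_field_model
begin

lemma bcontfun_fibre_continuous: "continuous_on A (\<lambda>v. apply_bcontfun f (v, y))"
  for f :: "(real \<times> real) \<Rightarrow>\<^sub>C real"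
  by (rule continuous_on_compose2[of UNIV "apply_bcontfun f"]) (auto intro!: continuous_intros)

lemma T_iterated:
  "apply_bcontfun (T f) z = (LBINT y:{0..1}. LBINT v:{0..2 * pi}. kernel z (v, y) * f (v, y))"
  unfolding apply_T
proof (rule integral_strip_measure_iterated)
  show "\<bar>kernel z w * f w\<bar> \<le> kernel_bound * norm f" for w
    using k_nonneg by (auto simp: abs_mult intro!: mult_mono kernel_le bcontfun_abs_le)
qed measurable

lemma T_even: "apply_bcontfun (T f) (- u, x) = T f (u, x)"
  by (simp add: apply_T kernel_even)

lemma T_periodic: "apply_bcontfun (T f) (u + 2 * pi, x) = T f (u, x)"
  by (simp add: apply_T kernel_periodic)

lemma integral_D_add: "(LBINT v:{0..2 * pi}. D (u + v)) = 2 * pi * D_mean"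
  using periodic_integral_shift[of "2 * pi" D u] D_periodic
  by (simp add: D_mean_def add.commute continuous_on_D)

lemma integral_D_diff: "(LBINT v:{0..2 * pi}. D (u - v)) = 2 * pi * D_mean"
proof -
  have "D (u - v) = D (- u + v)" for v
    using D_even[of "u - v"] by simp
  then show ?thesis
    by (simp only: integral_D_add)
qed

text \<open>This is the effect of subtracting \<open>D_mean\<close>: functions of x alone lie in the
  kernel of \<open>T\<close>, so by symmetry its range is orthogonal to all of them.\<close>

lemma integral_kernel: "(LBINT v:{0..2 * pi}. kernel z (v, y)) = 0"
proof -
  let ?u = "fst z"
  have "(LBINT v:{0..2 * pi}. (D (?u - v) + D (?u + v)) / 2 - D_mean)
      = ((LBINT v:{0..2 * pi}. D (?u - v)) + (LBINT v:{0..2 * pi}. D (?u + v))) / 2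
        - (LBINT v:{0..2 * pi}. D_mean)"
    by (subst set_integral_diff set_integral_add set_integral_divide_zero | simp add: continuous_intros)+
  also have "\<dots> = 0"
    by (simp only: integral_D_add integral_D_diff set_integral_const_interval) simp
  finally have "(LBINT v:{0..2 * pi}. (D (?u - v) + D (?u + v)) / 2 - D_mean) = 0" .
  moreover have "kernel z (v, y) = (- (\<beta> / (2 * pi)) * Wc (snd z) y) * ((D (?u - v) + D (?u + v)) / 2 - D_mean)" for v
    by (simp add: kernel_def)
  ultimately show ?thesis
    by (simp only: set_integral_mult_right mult_zero_right)
qed

lemma T_fibre_constant:
  assumes "\<And>v y. apply_bcontfun f (v, y) = f (0, y)"
  shows "T f = 0"
proof (rule bcontfun_eqI)
  fix z
  have "(LBINT v:{0..2 * pi}. kernel z (v, y) * f (v, y)) = 0" for y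
    by (subst assms) (simp add: integral_kernel)
  then show "apply_bcontfun (T f) z = apply_bcontfun 0 z"
    by (simp add: T_iterated)
qed

lemma abs_fibre_integral_le:
  assumes "continuous_on UNIV f" "\<And>v. \<bar>f v\<bar> \<le> (c::real)"
  shows "\<bar>LBINT v:{0..2 * pi}. f v\<bar> \<le> 2 * pi * c"
proof -
  have "\<bar>LBINT v:{0..2 * pi}. f v\<bar> \<le> (LBINT v:{0..2 * pi}. \<bar>f v\<bar>)"
    using set_integral_norm_bound[of lborel "{0..2 * pi}" f] assms(1) by simp
  also have "\<dots> \<le> (LBINT v:{0..2 * pi}. c)"
    by (intro set_integral_mono set_integrable_continuous_interval continuous_intros assms)
  finally show ?thesis by (simp only: set_integral_const_interval)
qed

text \<open>The orthogonal projection, with respect to \<open>B\<close>, onto functions of the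
  second variable.\<close>

definition fibre_mean :: "((real \<times> real) \<Rightarrow>\<^sub>C real) \<Rightarrow> ((real \<times> real) \<Rightarrow>\<^sub>C real)" where
  "fibre_mean f = Bcontfun (\<lambda>z. (LBINT v:{0..2 * pi}. f (v, snd z)) / (2 * pi))"

lemma abs_fibre_mean_aux:
  "\<bar>(LBINT v:{0..2 * pi}. apply_bcontfun f (v, y :: real)) / (2 * pi)\<bar> \<le> norm f"
proof -
  have "\<bar>LBINT v:{0..2 * pi}. f (v, y)\<bar> \<le> 2 * pi * norm f"
    by (intro abs_fibre_integral_le bcontfun_fibre_continuous bcontfun_abs_le)
  then show ?thesis
    by (simp add: pos_divide_le_eq mult.commute)
qed

lemma apply_fibre_mean:
  "apply_bcontfun (fibre_mean f) (u, y) = (LBINT v:{0..2 * pi}. f (v, y)) / (2 * pi)"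
proof -
  have joint: "continuous_on (UNIV \<times> cbox 0 (2 * pi)) (\<lambda>(y, v). apply_bcontfun f (v, y))"
    unfolding case_prod_beta'
    by (rule continuous_on_compose2[of UNIV "apply_bcontfun f"]) (simp, intro continuous_intros, simp)
  have "continuous_on UNIV (\<lambda>y. integral (cbox 0 (2 * pi)) (\<lambda>v. apply_bcontfun f (v, y)))"
    by (rule integral_continuous_on_param[OF joint])
  then have cont: "continuous_on UNIV (\<lambda>y. LBINT v:{0..2 * pi}. apply_bcontfun f (v, y))"
    by (simp add: set_borel_integral_eq_integral bcontfun_fibre_continuous)
  have "continuous_on UNIV (\<lambda>z :: real \<times> real. LBINT v:{0..2 * pi}. apply_bcontfun f (v, snd z))"
    by (rule continuous_on_compose2[OF cont, of _ snd]) (intro continuous_intros, simp)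
  then have "continuous_on UNIV (\<lambda>z :: real \<times> real. (LBINT v:{0..2 * pi}. apply_bcontfun f (v, snd z)) / (2 * pi))"
    by (intro continuous_on_divide continuous_on_const) auto
  then have "(\<lambda>z :: real \<times> real. (LBINT v:{0..2 * pi}. f (v, snd z)) / (2 * pi)) \<in> bcontfun"
    by (rule bcontfun_normI[where b="norm f"]) (use abs_fibre_mean_aux in simp)
  then show ?thesis
    by (simp add: fibre_mean_def Bcontfun_inverse)
qed

lemma norm_fibre_mean_le: "norm (fibre_mean f) \<le> norm f"
proof (rule norm_bound)
  show "norm (apply_bcontfun (fibre_mean f) z) \<le> norm f" for z
    using abs_fibre_mean_aux[of f "snd z"] by (cases z) (simp add: apply_fibre_mean)
qed

lemma fibre_mean_diff: "fibre_mean (f - g) = fibre_mean f - fibre_mean g"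
proof (rule bcontfun_eqI)
  fix z :: "real \<times> real"
  obtain u y where z: "z = (u, y)" by fastforce
  show "apply_bcontfun (fibre_mean (f - g)) z = apply_bcontfun (fibre_mean f - fibre_mean g) z"
    by (simp add: z apply_fibre_mean diff_divide_distrib bcontfun_fibre_continuous)
qed

lemma T_fibre_mean: "T (fibre_mean f) = 0"
  by (rule T_fibre_constant) (simp add: apply_fibre_mean)

lemma B_iterated: "B f g = (LBINT y:{0..1}. LBINT v:{0..2 * pi}. f (v, y) * g (v, y))"
  unfolding B_def
  by (rule integral_strip_measure_iterated[where c="norm f * norm g"])
    (auto simp: abs_mult intro!: mult_mono bcontfun_abs_le)

lemma B_fibre_mean: "B (fibre_mean f) g = B (fibre_mean f) (fibre_mean g)"
  unfolding B_iterated
  by (simp add: apply_fibre_mean[of _ _] set_integral_const_interval)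

text \<open>An eigenfunction for a nonzero eigenvalue lies in the range of \<open>T\<close>, which
  is orthogonal to every fibre mean.\<close>

lemma fibre_mean_eigenfunction:
  assumes "T h = \<mu> *\<^sub>R h" "\<mu> \<noteq> 0"
  shows "B (fibre_mean h) (fibre_mean h) = 0"
proof -
  have "\<mu> * B h (fibre_mean h) = B (T h) (fibre_mean h)"
    by (simp add: assms B_simps)
  also have "\<dots> = 0"
    by (simp add: T_symmetric T_fibre_mean B_simps)
  finally have "B h (fibre_mean h) = 0"
    using assms by simp
  then show ?thesis
    by (metis B_commute B_fibre_mean)
qed

text \<open>The quantity that \<open>D_mean\<close> multiplies in the difference between
  \<open>T\<close> and \<open>T_op\<close>; it is the graphon operator applied to the mass of each
  fibre.\<close>

definition weighted_mass :: "((real \<times> real) \<Rightarrow>\<^sub>C real) \<Rightarrow> real \<Rightarrow> real" where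
  "weighted_mass f x = (\<integral>w. Wc x (snd w) * f w \<partial>strip_measure)"

lemma weighted_mass_bound: "\<bar>Wc x (snd w) * apply_bcontfun f w\<bar> \<le> norm f"
  for w :: "real \<times> real"
proof -
  have "\<bar>Wc x (snd w) * f w\<bar> \<le> 1 * norm f"
    unfolding abs_mult using Wc_range by (intro mult_mono bcontfun_abs_le) auto
  then show ?thesis by simp
qed

lemma weighted_mass_fibre_mean: "weighted_mass (fibre_mean f) x = weighted_mass f x"
proof -
  have "weighted_mass f x = (LBINT y:{0..1}. LBINT v:{0..2 * pi}. Wc x y * f (v, y))" for f
    unfolding weighted_mass_def
    using integral_strip_measure_iterated[of "\<lambda>w. Wc x (snd w) * f w", OF _ weighted_mass_bound]
    by simp
  then show ?thesis
    by (simp add: apply_fibre_mean set_integral_const_interval)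
qed

text \<open>Fibre means do not change the weighted mass, and the fibre mean of an eigenfunction has
  seminorm zero; Cauchy-Schwarz turns this into vanishing at every \<open>x\<close>.\<close>

lemma weighted_mass_eigenfunction:
  assumes "T h = \<mu> *\<^sub>R h" "\<mu> \<noteq> 0"
  shows "weighted_mass h x = 0"
proof -
  let ?g = "fibre_mean h"
  have "(weighted_mass ?g x)\<^sup>2 \<le> (\<integral>w. (Wc x (snd w))\<^sup>2 \<partial>strip_measure) * (\<integral>w. (?g w)\<^sup>2 \<partial>strip_measure)"
    unfolding weighted_mass_def
  proof (rule Cauchy_Schwarz_integral)
    show "integrable strip_measure (\<lambda>w. (Wc x (snd w))\<^sup>2)"
    proof (rule integrable_bounded)
      show "\<bar>(Wc x (snd w))\<^sup>2\<bar> \<le> 1" for w :: "real \<times> real"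
        using Wc_range[of x "snd w"] by (simp add: power_le_one)
    qed measurable
  qed (auto simp: integrable_bcontfun_sq)
  also have "(\<integral>w. (?g w)\<^sup>2 \<partial>strip_measure) = 0"
    using fibre_mean_eigenfunction[OF assms] by (simp add: B_self)
  finally show ?thesis
    by (simp add: weighted_mass_fibre_mean)
qed

text \<open>On even periodic functions the symmetrisation has no effect, and the removed mode
  contributes a term depending on \<open>x\<close> alone. That term vanishes for eigenfunctions and
  cancels in the normalised exponential.\<close>

lemma T_eq_T_op:
  assumes even: "\<And>v y. y \<in> {0..1} \<Longrightarrow> apply_bcontfun f (- v, y) = f (v, y)"
    and per: "\<And>v y. y \<in> {0..1} \<Longrightarrow> apply_bcontfun f (v + 2 * pi, y) = f (v, y)"
    and x: "x \<in> {0..1}"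
  shows "apply_bcontfun (T f) (u, x) =
    T_op W D \<beta> (\<lambda>v y. f (v, y)) u x + \<beta> / (2 * pi) * D_mean * weighted_mass f x"
proof -
  define I where "I d = (\<integral>w. Wc x (snd w) * (d (fst w) * f w) \<partial>strip_measure)" for d
  have bound: "\<bar>Wc x (snd w) * (d (fst w) * f w)\<bar> \<le> D_bound * norm f" if "\<And>v. \<bar>d v\<bar> \<le> D_bound" for d w
  proof -
    have "\<bar>Wc x (snd w) * (d (fst w) * f w)\<bar> \<le> 1 * (D_bound * norm f)"
      unfolding abs_mult using Wc_range D_bound_nonneg by (intro mult_mono bcontfun_abs_le that) auto
    then show ?thesis by simp
  qed
  have int: "integrable strip_measure (\<lambda>w. Wc x (snd w) * (d (fst w) * f w))"
    if [measurable]: "d \<in> borel_measurable borel" and "\<And>v. \<bar>d v\<bar> \<le> D_bound" for d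
    by (rule integrable_bounded[OF _ bound[of d, OF that(2)]]) measurable
  have int_W: "integrable strip_measure (\<lambda>w. Wc x (snd w) * f w)"
    by (rule integrable_bounded[OF _ weighted_mass_bound]) measurable
  have iter: "I d = (LBINT y:{0..1}. LBINT v:{0..2 * pi}. Wc x y * (d v * f (v, y)))"
    if [measurable]: "d \<in> borel_measurable borel" and "\<And>v. \<bar>d v\<bar> \<le> D_bound" for d
    unfolding I_def
    using integral_strip_measure_iterated[of "\<lambda>w. Wc x (snd w) * (d (fst w) * f w)", OF _ bound[of d, OF that(2)]]
    by simp
  have Wc_W: "Wc x y = W x y" if "y \<in> {0..1}" for y
    using Wc_eq x that by blast
  have mf: "mean_field W D (\<lambda>v y. f (v, y)) u x = I (\<lambda>v. D (u - v))"
    unfolding mean_field_def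
    by (subst iter) (auto simp: abs_D_le Wc_W mult.assoc intro!: set_lebesgue_integral_cong)
  \<comment> \<open>Reflecting the integration variable exchanges the two halves of the symmetrised
    kernel, as \<open>f\<close> is even.\<close>
  have refl: "I (\<lambda>v. D (u + v)) = I (\<lambda>v. D (u - v))"
  proof -
    have "(LBINT v:{0..2 * pi}. D (u + v) * f (v, y)) = (LBINT v:{0..2 * pi}. D (u - v) * f (v, y))"
      if y: "y \<in> {0..1}" for y
    proof -
      have "D (u + (v + 2 * pi)) = D (u + v)" for v
        using D_periodic[of "u + v"] by (simp add: add.assoc)
      then have "(LBINT v:{0..2 * pi}. D (u + - v) * f (- v, y)) = (LBINT v:{0..2 * pi}. D (u + v) * f (v, y))"
        by (intro periodic_integral_reflect) (simp add: per[OF y])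
      then show ?thesis
        by (simp add: even[OF y])
    qed
    then show ?thesis
      by (subst (1 2) iter) (auto simp: abs_D_le intro!: set_lebesgue_integral_cong)
  qed
  have "apply_bcontfun (T f) (u, x) = (\<integral>w. - (\<beta> / (2 * pi)) *
      ((Wc x (snd w) * (D (u - fst w) * f w) + Wc x (snd w) * (D (u + fst w) * f w)) / 2
        - D_mean * (Wc x (snd w) * f w)) \<partial>strip_measure)"
    unfolding apply_T by (rule Bochner_Integration.integral_cong) (simp_all add: kernel_def algebra_simps add_divide_distrib)
  also have "\<dots> = - (\<beta> / (2 * pi)) *
      ((I (\<lambda>v. D (u - v)) + I (\<lambda>v. D (u + v))) / 2 - D_mean * weighted_mass f x)"
    using int[of "\<lambda>v. D (u - v)"] int[of "\<lambda>v. D (u + v)"] int_W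
    by (simp add: I_def weighted_mass_def abs_D_le)
  also have "\<dots> = - (\<beta> / (2 * pi)) * mean_field W D (\<lambda>v y. f (v, y)) u x + \<beta> / (2 * pi) * D_mean * weighted_mass f x"
    unfolding refl mf by (simp add: field_simps)
  finally show ?thesis
    by (simp add: T_op_def)
qed

end

section \<open>Fourier modes and their eigenfunctions\<close>

lemma cos_mult_periodic: "cos (real m * (v + 2 * pi)) = cos (real m * v)"
  and sin_mult_periodic: "sin (real m * (v + 2 * pi)) = sin (real m * v)"
  using periodic_shift_of_int[of cos "2 * pi" "real m * v" "int m"]
    periodic_shift_of_int[of sin "2 * pi" "real m * v" "int m"]
  by (simp_all add: distrib_left)

text \<open>A shift by half a wavelength changes the sign of the integrand but not the
  integral.\<close>

lemma integral_cos_eq_0: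
  assumes "1 \<le> m"
  shows "(LBINT v:{0..2 * pi}. cos (real m * v)) = 0"
proof -
  have "(LBINT v:{0..2 * pi}. cos (real m * (v + pi / real m))) = (LBINT v:{0..2 * pi}. cos (real m * v))"
    by (rule periodic_integral_shift) (auto simp: cos_mult_periodic intro!: continuous_intros)
  moreover have "cos (real m * (v + pi / real m)) = - cos (real m * v)" for v
    using assms by (simp add: distrib_left)
  ultimately show ?thesis
    by (simp add: set_lebesgue_integral_def)
qed

context mean_field_model
begin

text \<open>Shifting moves \<open>u\<close> into the cosine. The subtraction formula leaves a cosine
  and a sine integral, and the latter vanishes because \<open>D\<close> is even.\<close>

lemma integral_D_add_cos: "(LBINT v:{0..2 * pi}. D (u + v) * cos (real m * v)) = cos (real m * u) * cos_coeff D m"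
proof -
  let ?f = "\<lambda>v. D v * cos (real m * (v - u))"
  have "cos (real m * (v + 2 * pi - u)) = cos (real m * (v - u))" for v
    using cos_mult_periodic[of m "v - u"] by (simp add: algebra_simps)
  then have "(LBINT v:{0..2 * pi}. ?f (v + u)) = (LBINT v:{0..2 * pi}. ?f v)"
    by (intro periodic_integral_shift) (auto simp: D_periodic intro!: continuous_intros)
  then have "(LBINT v:{0..2 * pi}. D (u + v) * cos (real m * v)) = (LBINT v:{0..2 * pi}. ?f v)"
    by (simp add: add.commute)
  also have "\<dots> = (LBINT v:{0..2 * pi}. cos (real m * u) * (D v * cos (real m * v)) + sin (real m * u) * (D v * sin (real m * v)))"
    by (simp add: right_diff_distrib cos_diff algebra_simps)
  also have "\<dots> = cos (real m * u) * (LBINT v:{0..2 * pi}. D v * cos (real m * v))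
      + sin (real m * u) * (LBINT v:{0..2 * pi}. D v * sin (real m * v))"
    by (subst set_integral_add) (auto intro!: set_integrable_continuous_interval continuous_intros)
  also have "(LBINT v:{0..2 * pi}. D v * sin (real m * v)) = 0"
  proof -
    have "(LBINT v:{0..2 * pi}. D (- v) * sin (real m * (- v))) = (LBINT v:{0..2 * pi}. D v * sin (real m * v))"
      by (rule periodic_integral_reflect) (simp add: D_periodic sin_mult_periodic)
    then show ?thesis
      by (simp add: D_even set_lebesgue_integral_def)
  qed
  finally show ?thesis by (simp add: cos_coeff_def)
qed

lemma integral_D_diff_cos: "(LBINT v:{0..2 * pi}. D (u - v) * cos (real m * v)) = cos (real m * u) * cos_coeff D m"
proof -
  have "D (u - v) = D (- u + v)" for v
    using D_even[of "u - v"] by simp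
  then show ?thesis
    by (simp only: integral_D_add_cos) simp
qed

lemma integral_kernel_cos:
  assumes "1 \<le> m"
  shows "(LBINT v:{0..2 * pi}. kernel (u, x) (v, y) * cos (real m * v))
    = - (\<beta> / (2 * pi)) * cos_coeff D m * cos (real m * u) * Wc x y"
proof -
  have "(LBINT v:{0..2 * pi}. kernel (u, x) (v, y) * cos (real m * v))
      = (LBINT v:{0..2 * pi}. (- (\<beta> / (2 * pi)) * Wc x y) *
          (1 / 2 * (D (u - v) * cos (real m * v)) + 1 / 2 * (D (u + v) * cos (real m * v)) - D_mean * cos (real m * v)))"
    by (rule arg_cong[where f="set_lebesgue_integral lborel {0..2 * pi}"])
      (simp add: kernel_def fun_eq_iff algebra_simps add_divide_distrib)
  also have "\<dots> = (- (\<beta> / (2 * pi)) * Wc x y) *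
     (1 / 2 * (LBINT v:{0..2 * pi}. D (u - v) * cos (real m * v))
      + 1 / 2 * (LBINT v:{0..2 * pi}. D (u + v) * cos (real m * v))
      - D_mean * (LBINT v:{0..2 * pi}. cos (real m * v)))"
  proof -
    have "set_integrable lborel {0..2 * pi} (\<lambda>v. 1 / 2 * (D (u - v) * cos (real m * v)))"
      "set_integrable lborel {0..2 * pi} (\<lambda>v. 1 / 2 * (D (u + v) * cos (real m * v)))"
      "set_integrable lborel {0..2 * pi} (\<lambda>v. D_mean * cos (real m * v))"
      by (intro set_integrable_continuous_interval continuous_intros)+
    then show ?thesis
      by (simp only: set_integral_mult_right set_integral_add set_integral_diff)
  qed
  also have "\<dots> = - (\<beta> / (2 * pi)) * cos_coeff D m * cos (real m * u) * Wc x y"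
    unfolding integral_D_add_cos integral_D_diff_cos integral_cos_eq_0[OF assms] by (simp add: field_simps)
  finally show ?thesis .
qed

text \<open>\<open>V l\<close> is determined only almost everywhere, whereas a continuous
  eigenfunction is wanted. Its image \<open>G\<close> under the graphon operator is continuous by
  the L^1 continuity of \<open>W\<close> and agrees almost everywhere with \<open>lam l\<close>
  times \<open>V l\<close>, so \<open>G\<close> replaces it and is multiplied by the cosine.\<close>

lemma mode_eigenfunction:
  assumes basis: "graphon_eigenbasis W V lam" and l: "1 \<le> l" and m: "1 \<le> m" and lam: "lam l \<noteq> 0"
  obtains \<phi> where "\<phi> \<noteq> 0" "T \<phi> = mode_eigenvalue D \<beta> lam m l *\<^sub>R \<phi>"
proof -
  define V0 where "V0 y = indicator {0..1} y * V l y" for y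
  define a where "a x y = indicator {0..1} y * Wc x y" for x y
  define G where "G x = (\<integral>y. a x y * V0 y \<partial>lborel)" for x
  have V_meas [measurable]: "V0 \<in> borel_measurable borel"
    and V_int: "integrable lborel (\<lambda>y. (V0 y)\<^sup>2)"
    and V_1: "(\<integral>y. (V0 y)\<^sup>2 \<partial>lborel) = 1"
    and V_eigen: "AE x in lborel. x \<in> {0..1} \<longrightarrow> graphon_op W (V l) x = lam l * V l x"
  proof -
    have sq: "indicator {0..1} y * (V l y)\<^sup>2 = (V0 y)\<^sup>2" for y
      by (auto simp: V0_def indicator_def)
    have "V l \<in> L2_unit" "(LBINT x:{0..1}. V l x * V l x) = 1"
      "AE x in lborel. x \<in> {0..1} \<longrightarrow> graphon_op W (V l) x = lam l * V l x"
      using basis l by (auto simp: graphon_eigenbasis_def)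
    then show "V0 \<in> borel_measurable borel" "integrable lborel (\<lambda>y. (V0 y)\<^sup>2)"
      "(\<integral>y. (V0 y)\<^sup>2 \<partial>lborel) = 1"
      "AE x in lborel. x \<in> {0..1} \<longrightarrow> graphon_op W (V l) x = lam l * V l x"
      by (auto simp: L2_unit_def set_borel_measurable_def set_integrable_def set_lebesgue_integral_def
          V0_def[abs_def] sq[unfolded V0_def] power2_eq_square[symmetric])
  qed
  have a_meas [measurable]: "a x \<in> borel_measurable borel" for x
    unfolding a_def[abs_def] by measurable
  have a_int: "integrable lborel (\<lambda>y. indicator {0..1} y * f y)"
    if [measurable]: "f \<in> borel_measurable borel" and le: "\<And>y. \<bar>f y\<bar> \<le> 1" for f :: "real \<Rightarrow> real"
  proof (rule Bochner_Integration.integrable_bound)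
    show "integrable lborel (indicator {0..1} :: real \<Rightarrow> real)"
      by simp
    show "AE y in lborel. norm (indicator {0..1} y * f y) \<le> norm (indicator {0..1} y :: real)"
      using le by (auto simp: indicator_def)
  qed measurable
  have W2: "\<bar>(Wc x y)\<^sup>2\<bar> \<le> 1" for x y
    using Wc_range[of x y] by (simp add: power_le_one)
  have Wd: "\<bar>Wc x y - Wc x' y\<bar> \<le> 1" for x x' y
    using Wc_range[of x y] Wc_range[of x' y] by linarith
  have a2: "integrable lborel (\<lambda>y. (a x y)\<^sup>2)" for x
  proof -
    have "(a x y)\<^sup>2 = indicator {0..1} y * (Wc x y)\<^sup>2" for y
      by (auto simp: a_def indicator_def)
    then show ?thesis
      using a_int[of "\<lambda>y. (Wc x y)\<^sup>2", OF _ W2[of x]] by simp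
  qed
  have ad2: "integrable lborel (\<lambda>y. (a x y - a x' y)\<^sup>2)"
    and ad2_le: "(\<integral>y. (a x y - a x' y)\<^sup>2 \<partial>lborel) \<le> (LBINT y:{0..1}. \<bar>Wc x y - Wc x' y\<bar>)" for x x'
  proof -
    have eq: "(a x y - a x' y)\<^sup>2 = indicator {0..1} y * (Wc x y - Wc x' y)\<^sup>2" for y
      by (auto simp: a_def indicator_def)
    have "(Wc x y - Wc x' y)\<^sup>2 \<le> \<bar>Wc x y - Wc x' y\<bar>" for y
      using mult_right_mono[OF Wd[of x y x'], of "\<bar>Wc x y - Wc x' y\<bar>"] by (simp add: power2_eq_square)
    moreover have int: "integrable lborel (\<lambda>y. indicator {0..1} y * (Wc x y - Wc x' y)\<^sup>2)"
      by (rule a_int) (use Wd[of x _ x'] in \<open>auto simp: abs_square_le_1\<close>)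
    moreover have "integrable lborel (\<lambda>y. indicator {0..1} y * \<bar>Wc x y - Wc x' y\<bar>)"
      by (rule a_int) (use Wd in auto)
    ultimately show "(\<integral>y. (a x y - a x' y)\<^sup>2 \<partial>lborel) \<le> (LBINT y:{0..1}. \<bar>Wc x y - Wc x' y\<bar>)"
      unfolding eq set_lebesgue_integral_def by (auto intro!: integral_mono mult_left_mono)
    show "integrable lborel (\<lambda>y. (a x y - a x' y)\<^sup>2)"
      unfolding eq by (rule int)
  qed
  have int_aV: "integrable lborel (\<lambda>y. a x y * V0 y)" for x
    by (rule integrable_mult_of_squares) (use a2 V_int in auto)
  have G_le: "\<bar>G x\<bar> \<le> 1" for x
  proof -
    have "(G x)\<^sup>2 \<le> (\<integral>y. (a x y)\<^sup>2 \<partial>lborel) * 1"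
      unfolding G_def using Cauchy_Schwarz_integral[of "a x" lborel V0] a2 V_int V_1 by simp
    also have "(\<integral>y. (a x y)\<^sup>2 \<partial>lborel) \<le> (\<integral>y. indicator {0..1::real} y \<partial>lborel)"
    proof (rule integral_mono[OF a2])
      show "(a x y)\<^sup>2 \<le> indicator {0..1} y" for y
        using W2[of x y] by (auto simp: a_def indicator_def)
    qed simp
    finally show ?thesis
      by (simp add: abs_square_le_1)
  qed
  have G_diff: "(G x - G x')\<^sup>2 \<le> (LBINT y:{0..1}. \<bar>Wc x y - Wc x' y\<bar>)" for x x'
  proof -
    have "G x - G x' = (\<integral>y. (a x y - a x' y) * V0 y \<partial>lborel)"
      using int_aV by (simp add: G_def left_diff_distrib)
    then have "(G x - G x')\<^sup>2 \<le> (\<integral>y. (a x y - a x' y)\<^sup>2 \<partial>lborel)"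
      using Cauchy_Schwarz_integral[of "\<lambda>y. a x y - a x' y" lborel V0] ad2 V_int V_1 by simp
    then show ?thesis
      using ad2_le[of x x'] by linarith
  qed
  have cont_G: "continuous_on A G" for A
    unfolding continuous_on_iff
  proof (intro ballI allI impI)
    fix x and e :: real assume "0 < e"
    then obtain \<delta> where \<delta>: "0 < \<delta>"
      "\<And>x x'. \<bar>x - x'\<bar> < \<delta> \<Longrightarrow> (LBINT y:{0..1}. \<bar>Wc x y - Wc x' y\<bar>) < e\<^sup>2"
      using Wc_L1_continuous[of "e\<^sup>2"] by auto
    have "\<bar>G x' - G x\<bar> < e" if "\<bar>x' - x\<bar> < \<delta>" for x'
    proof -
      have "\<bar>G x' - G x\<bar>\<^sup>2 < e\<^sup>2"
        using G_diff[of x' x] \<delta>(2)[OF that] by simp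
      then show ?thesis
        by (rule power2_less_imp_less) (use \<open>0 < e\<close> in simp)
    qed
    then show "\<exists>d>0. \<forall>x'\<in>A. dist x' x < d \<longrightarrow> dist (G x') (G x) < e"
      using \<delta>(1) by (auto simp: dist_real_def)
  qed
  have G_meas [measurable]: "G \<in> borel_measurable borel"
    by (intro borel_measurable_continuous_onI cont_G)
  have G_op: "G x = graphon_op W (V l) x" if "x \<in> {0..1}" for x
  proof -
    have "graphon_op W (V l) x = (LBINT y:{0..1}. Wc x y * V l y)"
      unfolding graphon_op_def using that by (intro set_lebesgue_integral_cong) (auto simp: Wc_def)
    then show ?thesis
      unfolding G_def set_lebesgue_integral_def
      by (auto simp: a_def V0_def indicator_def intro!: Bochner_Integration.integral_cong)
  qed
  have V_G: "AE y in lborel. V0 y = indicator {0..1} y * (G y / lam l)"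
    using V_eigen
  proof eventually_elim
    case (elim y)
    then show ?case
      using lam G_op[of y] by (auto simp: V0_def indicator_def)
  qed
  \<comment> \<open>Replacing \<open>V0\<close> by \<open>G\<close> under the integral alters it on
    a null set only, so the eigenvalue equation for \<open>G\<close> holds at every
    \<open>x\<close>.\<close>
  have G_eigen: "(LBINT y:{0..1}. Wc x y * G y) = lam l * G x" for x
  proof -
    have "G x = (\<integral>y. a x y * V0 y \<partial>lborel)"
      by (rule G_def)
    also have "\<dots> = (\<integral>y. a x y * (indicator {0..1} y * (G y / lam l)) \<partial>lborel)"
    proof (rule integral_cong_AE)
      show "AE y in lborel. a x y * V0 y = a x y * (indicator {0..1} y * (G y / lam l))"
        using V_G by eventually_elim simp
    qed measurable
    also have "\<dots> = (LBINT y:{0..1}. Wc x y * G y / lam l)"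
      unfolding set_lebesgue_integral_def
      by (intro Bochner_Integration.integral_cong) (auto simp: a_def indicator_def)
    finally show ?thesis
      using lam by (simp add: field_simps)
  qed
  define \<phi> where "\<phi> = Bcontfun (\<lambda>z. G (snd z) * cos (real m * fst z))"
  have apply_\<phi>: "apply_bcontfun \<phi> (u, x) = G x * cos (real m * u)" for u x
  proof -
    have "continuous_on UNIV (\<lambda>z :: real \<times> real. G (snd z) * cos (real m * fst z))"
      by (intro continuous_intros continuous_on_compose2[OF cont_G[of UNIV]]) auto
    moreover have "norm (G (snd z) * cos (real m * fst z)) \<le> 1" for z :: "real \<times> real"
      using mult_mono[OF G_le[of "snd z"] abs_cos_le_one[of "real m * fst z"]] by (simp add: abs_mult)
    ultimately have "(\<lambda>z :: real \<times> real. G (snd z) * cos (real m * fst z)) \<in> bcontfun"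
      by (rule bcontfun_normI)
    then show ?thesis
      by (simp add: \<phi>_def Bcontfun_inverse)
  qed
  have "\<phi> \<noteq> 0"
  proof
    assume "\<phi> = 0"
    then have "G x = 0" for x
      using apply_\<phi>[of 0 x] by simp
    then have "AE y in lborel. (V0 y)\<^sup>2 = 0"
      using V_G by (auto elim!: eventually_mono)
    then have "(\<integral>y. (V0 y)\<^sup>2 \<partial>lborel) = 0"
      by (rule integral_eq_zero_AE)
    then show False using V_1 by simp
  qed
  moreover have "T \<phi> = mode_eigenvalue D \<beta> lam m l *\<^sub>R \<phi>"
  proof (rule bcontfun_eqI)
    fix z :: "real \<times> real"
    obtain u x where z: "z = (u, x)" by fastforce
    have "apply_bcontfun (T \<phi>) z = (LBINT y:{0..1}. G y * (LBINT v:{0..2 * pi}. kernel (u, x) (v, y) * cos (real m * v)))"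
      unfolding z T_iterated apply_\<phi> set_integral_mult_right[symmetric] by (simp only: mult_ac)
    also have "\<dots> = (LBINT y:{0..1}. (- (\<beta> / (2 * pi)) * cos_coeff D m * cos (real m * u)) * (Wc x y * G y))"
      unfolding integral_kernel_cos[OF m] by (simp only: mult_ac)
    also have "\<dots> = (- (\<beta> / (2 * pi)) * cos_coeff D m * cos (real m * u)) * (lam l * G x)"
      by (simp only: set_integral_mult_right G_eigen)
    finally show "apply_bcontfun (T \<phi>) z = apply_bcontfun (mode_eigenvalue D \<beta> lam m l *\<^sub>R \<phi>) z"
      by (simp add: z apply_\<phi> mode_eigenvalue_def)
  qed
  ultimately show thesis by (rule that)
qed

section \<open>From simplicity in L^2 to simplicity among bounded continuous functions\<close>

lemma eigenfunction_even: "T h = \<mu> *\<^sub>R h \<Longrightarrow> \<mu> \<noteq> 0 \<Longrightarrow> apply_bcontfun h (- u, x) = h (u, x)"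
  and eigenfunction_periodic: "T h = \<mu> *\<^sub>R h \<Longrightarrow> \<mu> \<noteq> 0 \<Longrightarrow> apply_bcontfun h (u + 2 * pi, x) = h (u, x)"
  using T_even[of h u x] T_periodic[of h u x] by simp_all

lemma bcontfun_L2_even:
  assumes "\<And>u x. apply_bcontfun h (- u, x) = h (u, x)" "\<And>u x. apply_bcontfun h (u + 2 * pi, x) = h (u, x)"
  shows "(\<lambda>u x. apply_bcontfun h (u, x)) \<in> L2_even"
proof -
  have "set_integrable lborel strip (\<lambda>z. (apply_bcontfun h z)\<^sup>2)"
  proof (rule bounded_set_integrable_strip)
    show "\<bar>(apply_bcontfun h z)\<^sup>2\<bar> \<le> (norm h)\<^sup>2" for z
      using bcontfun_abs_le[of h z] by (simp add: abs_le_square_iff[symmetric])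
  qed measurable
  then show ?thesis
    using assms by (auto simp: L2_even_def set_borel_measurable_def case_prod_beta')
qed

lemma eigenfunction_in_T_eigenspace:
  assumes "T h = \<mu> *\<^sub>R h" "\<mu> \<noteq> 0"
  shows "(\<lambda>u x. apply_bcontfun h (u, x)) \<in> T_eigenspace W D \<beta> \<mu>"
proof -
  have "T_op W D \<beta> (\<lambda>u x. apply_bcontfun h (u, x)) (fst z) (snd z) = \<mu> * h (fst z, snd z)" if "z \<in> strip" for z
    using T_eq_T_op[of h "snd z" "fst z"] that eigenfunction_even[OF assms] eigenfunction_periodic[OF assms]
    by (simp add: weighted_mass_eigenfunction[OF assms] assms strip_def mem_Times_iff)
  then show ?thesis
    using eigenfunction_even[OF assms] eigenfunction_periodic[OF assms]
    by (simp add: T_eigenspace_def bcontfun_L2_even)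
qed

lemma B_self_strip: "B f f = (LINT z:strip|lborel. (apply_bcontfun f z)\<^sup>2)"
  unfolding B_self by (rule integral_strip_measure) measurable

lemma B_eq_0_AE:
  assumes "AE z in lborel. z \<in> strip \<longrightarrow> apply_bcontfun f z = 0"
  shows "B f f = 0"
  unfolding B_self_strip set_lebesgue_integral_def
  by (rule integral_eq_zero_AE) (use assms in \<open>auto elim!: eventually_mono simp: indicator_def\<close>)

text \<open>Both \<open>h\<close> and \<open>\<phi>\<close> belong to the one-dimensional eigenspace
  of \<open>T_op\<close>, so they are proportional almost everywhere on the strip. It remains to
  remove the exceptional set.\<close>

lemma simple_eigenvalue_locale:
  assumes simple: "simple_eigenvalue W D \<beta> \<mu>" and \<mu>: "\<mu> \<noteq> 0"
    and \<phi>: "\<phi> \<noteq> 0" "T \<phi> = \<mu> *\<^sub>R \<phi>"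
  shows "simple_nonzero_eigenvalue T B (kernel_bound\<^sup>2 * measure strip_measure (space strip_measure)) \<mu> \<phi>"
proof (intro simple_nonzero_eigenvalue.intro simple_nonzero_eigenvalue_axioms.intro)
  fix h assume h: "T h = \<mu> *\<^sub>R h" "B h \<phi> = 0"
  obtain p where p: "\<And>q. q \<in> T_eigenspace W D \<beta> \<mu> \<Longrightarrow>
      \<exists>c. AE z in lborel. z \<in> strip \<longrightarrow> q (fst z) (snd z) = c * p (fst z) (snd z)"
    using simple unfolding simple_eigenvalue_def by blast
  obtain c where c: "AE z in lborel. z \<in> strip \<longrightarrow> apply_bcontfun h z = c * p (fst z) (snd z)"
    using p[OF eigenfunction_in_T_eigenspace[OF h(1) \<mu>]] by auto
  obtain d where d: "AE z in lborel. z \<in> strip \<longrightarrow> apply_bcontfun \<phi> z = d * p (fst z) (snd z)"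
    using p[OF eigenfunction_in_T_eigenspace[OF \<phi>(2) \<mu>]] by auto
  have pos: "0 < B \<phi> \<phi>"
    using eigenvector_pos[OF \<phi>(2) \<mu> \<phi>(1)] .
  have "d \<noteq> 0"
  proof
    assume "d = 0"
    then have "B \<phi> \<phi> = 0"
      using d by (intro B_eq_0_AE) simp
    then show False using pos by simp
  qed
  \<comment> \<open>This combination has seminorm zero, so \<open>T\<close> annihilates it; but
    \<open>T\<close> also multiplies it by \<open>\<mu>\<close>, hence it vanishes as a function on
    the whole plane.\<close>
  let ?w = "d *\<^sub>R h - c *\<^sub>R \<phi>"
  have "B ?w ?w = 0"
  proof (rule B_eq_0_AE)
    show "AE z in lborel. z \<in> strip \<longrightarrow> apply_bcontfun ?w z = 0"
      using c d by eventually_elim auto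
  qed
  then have "T ?w = 0"
    by (rule T_eq_0)
  moreover have "T ?w = \<mu> *\<^sub>R ?w"
    by (simp add: T.diff T.scaleR h \<phi> algebra_simps)
  ultimately have w: "?w = 0"
    using \<mu> by simp
  have "B ?w \<phi> = 0"
    unfolding w by (simp add: B_simps)
  then have "c = 0"
    using pos h(2) by (simp add: B_simps)
  then show "h = 0"
    using w \<open>d \<noteq> 0\<close> by simp
qed (use assms compact_symmetric_operator in auto)

end

section \<open>The stationary states\<close>

lemma abs_exp_diff_le:
  fixes x y :: real
  assumes "\<bar>x\<bar> \<le> 1" "\<bar>y\<bar> \<le> 1"
  shows "\<bar>exp x - exp y\<bar> \<le> 3 * \<bar>x - y\<bar>"
proof -
  have "exp x - exp y \<le> 3 * \<bar>x - y\<bar>" if "\<bar>x\<bar> \<le> 1" for x y :: real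
  proof -
    have "exp x * (1 + (y - x)) \<le> exp x * exp (y - x)"
      by (intro mult_left_mono exp_ge_add_one_self) simp
    also have "\<dots> = exp y"
      by (simp flip: exp_add)
    finally have "exp x - exp y \<le> exp x * (x - y)"
      by (simp add: algebra_simps)
    also have "\<dots> \<le> exp x * \<bar>x - y\<bar>"
      by (intro mult_left_mono) auto
    also have "\<dots> \<le> 3 * \<bar>x - y\<bar>"
    proof (intro mult_right_mono)
      have "exp x \<le> exp 1" using that by simp
      then show "exp x \<le> 3" using exp_le by linarith
    qed simp
    finally show ?thesis .
  qed
  from this[OF assms(1), of y] this[OF assms(2), of x] show ?thesis
    by (simp add: abs_minus_commute)
qed

text \<open>The derivative of exp x - x vanishes at 0, so on the segment between the points it is
  bounded by a multiple of their size; the mean value inequality does the rest.\<close>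

lemma exp_remainder_diff_le:
  fixes x y :: real
  assumes "\<bar>x\<bar> \<le> 1" "\<bar>y\<bar> \<le> 1"
  shows "\<bar>(exp x - x) - (exp y - y)\<bar> \<le> 3 * (\<bar>x\<bar> + \<bar>y\<bar>) * \<bar>x - y\<bar>"
proof -
  have "norm ((exp x - x) - (exp y - y)) \<le> 3 * (\<bar>x\<bar> + \<bar>y\<bar>) * norm (x - y)"
  proof (rule field_differentiable_bound[of "closed_segment x y"])
    fix t assume "t \<in> closed_segment x y"
    then have t: "\<bar>t\<bar> \<le> max \<bar>x\<bar> \<bar>y\<bar>"
      by (auto simp: closed_segment_eq_real_ivl split: if_splits)
    show "((\<lambda>x. exp x - x) has_field_derivative (exp t - 1)) (at t within closed_segment x y)"
      by (auto intro!: derivative_eq_intros)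
    have "\<bar>exp t - exp 0\<bar> \<le> 3 * \<bar>t - 0\<bar>"
      using t assms by (intro abs_exp_diff_le) auto
    then show "norm (exp t - 1) \<le> 3 * (\<bar>x\<bar> + \<bar>y\<bar>)"
      using t by simp
  qed auto
  then show ?thesis by simp
qed

section \<open>The normalised exponential and its quadratic remainder\<close>

context mean_field_model
begin

definition exp_bcontfun :: "((real \<times> real) \<Rightarrow>\<^sub>C real) \<Rightarrow> ((real \<times> real) \<Rightarrow>\<^sub>C real)" where
  "exp_bcontfun f = Bcontfun (\<lambda>z. exp (f z))"

lemma apply_exp: "apply_bcontfun (exp_bcontfun f) z = exp (f z)"
proof -
  have "(\<lambda>z. exp (apply_bcontfun f z)) \<in> bcontfun"
  proof (rule bcontfun_normI)
    show "norm (exp (apply_bcontfun f z)) \<le> exp (norm f)" for z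
      using bcontfun_abs_le[of f z] by simp
  qed (intro continuous_intros continuous_on_apply_bcontfun)
  then show ?thesis
    by (simp add: exp_bcontfun_def Bcontfun_inverse)
qed

text \<open>An average rather than an integral over the circle, so that the normalised exponential
  of 0 is the constant 1; densities are recovered on division by \<open>2 * pi\<close>.\<close>

definition partition_fn :: "((real \<times> real) \<Rightarrow>\<^sub>C real) \<Rightarrow> ((real \<times> real) \<Rightarrow>\<^sub>C real)" where
  "partition_fn f = fibre_mean (exp_bcontfun f)"

lemma partition_fn_ge: "exp (- norm f) \<le> apply_bcontfun (partition_fn f) z"
proof -
  obtain u y where z: "z = (u, y)" by fastforce
  have "2 * pi * exp (- norm f) = (LBINT v:{0..2 * pi}. exp (- norm f))"
    by (simp only: set_integral_const_interval)
  also have "\<dots> \<le> (LBINT v:{0..2 * pi}. exp_bcontfun f (v, y))"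
  proof (intro set_integral_mono set_integrable_continuous_interval bcontfun_fibre_continuous continuous_on_const)
    show "exp (- norm f) \<le> apply_bcontfun (exp_bcontfun f) (v, y)" for v
      using bcontfun_abs_le[of f "(v, y)"] by (simp add: apply_exp abs_le_iff)
  qed
  finally show ?thesis
    by (simp add: z partition_fn_def apply_fibre_mean pos_le_divide_eq mult.commute)
qed

lemma partition_fn_pos: "0 < apply_bcontfun (partition_fn f) z"
  using partition_fn_ge[of f z] exp_gt_zero[of "- norm f"] by linarith

lemma partition_fn_fibre: "apply_bcontfun (partition_fn f) (u, y) = partition_fn f (v, y)"
  by (simp add: partition_fn_def apply_fibre_mean)

definition gibbs :: "((real \<times> real) \<Rightarrow>\<^sub>C real) \<Rightarrow> ((real \<times> real) \<Rightarrow>\<^sub>C real)" where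
  "gibbs f = Bcontfun (\<lambda>z. exp (f z) / partition_fn f z)"

lemma apply_gibbs: "apply_bcontfun (gibbs f) z = exp (f z) / partition_fn f z"
proof -
  have "(\<lambda>z. exp (apply_bcontfun f z) / partition_fn f z) \<in> bcontfun"
  proof (rule bcontfun_normI)
    show "continuous_on UNIV (\<lambda>z. exp (apply_bcontfun f z) / partition_fn f z)"
      using partition_fn_pos[of f] by (intro continuous_intros continuous_on_apply_bcontfun) (metis less_irrefl)
    show "norm (exp (apply_bcontfun f z) / partition_fn f z) \<le> exp (norm f) / exp (- norm f)" for z
      using bcontfun_abs_le[of f z] partition_fn_ge[of f z] partition_fn_pos[of f z]
      by (auto intro!: frac_le simp: abs_le_iff)
  qed
  then show ?thesis
    by (simp add: gibbs_def Bcontfun_inverse)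
qed

lemma integral_gibbs: "(LBINT v:{0..2 * pi}. apply_bcontfun (gibbs f) (v, y)) = 2 * pi"
proof -
  have "apply_bcontfun (gibbs f) (v, y) = exp_bcontfun f (v, y) / partition_fn f (0, y)" for v
    by (simp only: apply_gibbs apply_exp partition_fn_fibre[of f v y 0])
  then have "(LBINT v:{0..2 * pi}. apply_bcontfun (gibbs f) (v, y))
      = (LBINT v:{0..2 * pi}. exp_bcontfun f (v, y)) / partition_fn f (0, y)"
    by (simp only: set_integral_divide_zero)
  also have "\<dots> = 2 * pi"
    using partition_fn_pos[of f "(0, y)"] by (auto simp: partition_fn_def apply_fibre_mean)
  finally show ?thesis .
qed

abbreviation "one_bcontfun \<equiv> const_bcontfun (1 :: real) :: (real \<times> real) \<Rightarrow>\<^sub>C real"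

lemma T_one: "T one_bcontfun = 0"
  by (rule T_fibre_constant) simp

lemma fibre_mean_one: "fibre_mean one_bcontfun = one_bcontfun"
  by (rule bcontfun_eqI) (auto simp: apply_fibre_mean set_integral_const_interval)

lemma norm_exp_sub_le:
  assumes "norm f \<le> 1" "norm g \<le> 1"
  shows "norm (exp_bcontfun f - exp_bcontfun g) \<le> 3 * norm (f - g)"
proof (rule norm_bound)
  fix z
  have "\<bar>exp (f z) - exp (g z)\<bar> \<le> 3 * \<bar>f z - g z\<bar>"
    using bcontfun_abs_le[of f z] bcontfun_abs_le[of g z] assms by (intro abs_exp_diff_le) auto
  also have "\<dots> \<le> 3 * norm (f - g)"
    using bcontfun_abs_le[of "f - g" z] by simp
  finally show "norm (apply_bcontfun (exp_bcontfun f - exp_bcontfun g) z) \<le> 3 * norm (f - g)"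
    by (simp add: apply_exp)
qed

lemma partition_fn_diff_le:
  assumes "norm f \<le> 1" "norm g \<le> 1"
  shows "\<bar>apply_bcontfun (partition_fn f) z - partition_fn g z\<bar> \<le> 3 * norm (f - g)"
proof -
  have "norm (partition_fn f - partition_fn g) \<le> norm (exp_bcontfun f - exp_bcontfun g)"
    unfolding partition_fn_def fibre_mean_diff[symmetric] by (rule norm_fibre_mean_le)
  then show ?thesis
    using norm_exp_sub_le[OF assms] bcontfun_abs_le[of "partition_fn f - partition_fn g" z] by simp
qed

lemma exp_bcontfun_0: "exp_bcontfun 0 = one_bcontfun"
  by (rule bcontfun_eqI) (simp add: apply_exp)

lemma partition_fn_0: "partition_fn 0 = one_bcontfun"
  by (simp add: partition_fn_def exp_bcontfun_0 fibre_mean_one)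

lemma gibbs_0: "gibbs 0 = one_bcontfun"
  by (rule bcontfun_eqI) (simp add: apply_gibbs partition_fn_0)

lemma gibbs_diff_le:
  assumes f: "norm f \<le> 1" and g: "norm g \<le> 1"
  shows "\<bar>apply_bcontfun (gibbs f) z - gibbs g z\<bar> \<le> 90 * norm (f - g)"
proof -
  have low: "1 / 3 \<le> apply_bcontfun (partition_fn h) z" if "norm h \<le> 1" for h
  proof -
    have "exp 1 \<le> (3 :: real)" by (rule exp_le)
    then have "1 / 3 \<le> exp (- 1 :: real)" by (simp add: exp_minus field_simps)
    also have "\<dots> \<le> exp (- norm h)" using that by simp
    also have "\<dots> \<le> partition_fn h z" by (rule partition_fn_ge)
    finally show ?thesis .
  qed
  let ?a = "exp (f z)" and ?b = "exp (g z)" and ?p = "apply_bcontfun (partition_fn f) z"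
    and ?q = "apply_bcontfun (partition_fn g) z"
  have pq: "1 / 3 \<le> ?p" "1 / 3 \<le> ?q" using low f g by auto
  have "?b \<le> exp 1"
    using bcontfun_abs_le[of g z] g by simp
  then have b: "0 \<le> ?b" "?b \<le> 3"
    using exp_le by (simp, rule order_trans)
  have ab: "\<bar>?a - ?b\<bar> \<le> 3 * norm (f - g)"
    using norm_exp_sub_le[OF f g] bcontfun_abs_le[of "exp_bcontfun f - exp_bcontfun g" z] by (simp add: apply_exp)
  have "gibbs f z - gibbs g z = (?a - ?b) * (1 / ?p) + ?b * (1 / ?p) * (1 / ?q) * (?q - ?p)"
    using pq by (simp add: apply_gibbs field_simps)
  then have "\<bar>gibbs f z - gibbs g z\<bar> \<le> \<bar>?a - ?b\<bar> * \<bar>1 / ?p\<bar> + \<bar>?b\<bar> * \<bar>1 / ?p\<bar> * \<bar>1 / ?q\<bar> * \<bar>?q - ?p\<bar>"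
    by (metis abs_mult abs_triangle_ineq)
  \<comment> \<open>Numerators and reciprocals of normalisations are all at most 3 on the unit ball,
    as e is at most 3; the constants 9 and 81 add up to 90.\<close>
  also have "\<dots> \<le> (3 * norm (f - g)) * 3 + 3 * 3 * 3 * (3 * norm (f - g))"
    using pq b ab partition_fn_diff_le[OF g f, of z]
    by (intro add_mono mult_mono) (auto simp: field_simps norm_minus_commute)
  finally show ?thesis by simp
qed

lemma norm_gibbs_sub_one_le:
  assumes "norm f \<le> 1"
  shows "norm (gibbs f - one_bcontfun) \<le> 90 * norm f"
proof (rule norm_bound)
  show "norm (apply_bcontfun (gibbs f - one_bcontfun) z) \<le> 90 * norm f" for z
    using gibbs_diff_le[OF assms, of 0 z] by (simp add: gibbs_0)
qed

text \<open>To first order \<open>gibbs f\<close> is 1 plus \<open>f\<close> minus its fibre mean,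
  and \<open>partition_fn f\<close> is 1 plus that mean, so adding it cancels the linear part. It
  depends on the second variable only, so \<open>T\<close> does not notice it.\<close>

definition gibbs_remainder :: "((real \<times> real) \<Rightarrow>\<^sub>C real) \<Rightarrow> ((real \<times> real) \<Rightarrow>\<^sub>C real)" where
  "gibbs_remainder f = gibbs f - f + partition_fn f"

lemma T_gibbs_remainder: "T (gibbs_remainder f) = T (gibbs f) - T f"
  by (simp add: gibbs_remainder_def T.add T.diff partition_fn_def T_fibre_mean)

text \<open>Writing \<open>q\<close> for the normalised exponential and \<open>Z\<close> for its normalisation, \<open>q Z = e\<^sup>f\<close> gives
  \<open>q - f + Z = (e\<^sup>f - f) + 1 - (Z - 1) (q - 1)\<close>, where both varying terms are quadratic.\<close>
lemma gibbs_remainder_diff_le: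
  assumes f: "norm f \<le> 1" and g: "norm g \<le> 1"
  shows "norm (gibbs_remainder f - gibbs_remainder g) \<le> 600 * (norm f + norm g) * norm (f - g)"
proof (rule norm_bound)
  fix z
  define P where "P h = apply_bcontfun (partition_fn h) z - 1" for h
  define Q where "Q h = apply_bcontfun (gibbs h) z - 1" for h
  have eq: "gibbs_remainder h z = (exp (h z) - h z) + 1 - P h * Q h" for h
  proof -
    have "gibbs h z * partition_fn h z = exp (h z)"
      using partition_fn_pos[of h z] by (simp add: apply_gibbs)
    then show ?thesis
      by (simp add: gibbs_remainder_def P_def Q_def algebra_simps)
  qed
  have E: "\<bar>(exp (f z) - f z) - (exp (g z) - g z)\<bar> \<le> 3 * (norm f + norm g) * norm (f - g)"
  proof -
    have "\<bar>(exp (f z) - f z) - (exp (g z) - g z)\<bar> \<le> 3 * (\<bar>f z\<bar> + \<bar>g z\<bar>) * \<bar>f z - g z\<bar>"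
      using bcontfun_abs_le[of f z] bcontfun_abs_le[of g z] f g by (intro exp_remainder_diff_le) auto
    also have "\<dots> \<le> 3 * (norm f + norm g) * norm (f - g)"
      using bcontfun_abs_le[of f z] bcontfun_abs_le[of g z] bcontfun_abs_le[of "f - g" z]
      by (intro mult_mono) auto
    finally show ?thesis .
  qed
  have P: "\<bar>P f - P g\<bar> \<le> 3 * norm (f - g)" "\<bar>P g\<bar> \<le> 3 * norm g"
    using partition_fn_diff_le[OF f g, of z] partition_fn_diff_le[OF g, of 0 z]
    by (simp_all add: P_def partition_fn_0)
  have Q: "\<bar>Q f - Q g\<bar> \<le> 90 * norm (f - g)" "\<bar>Q f\<bar> \<le> 90 * norm f"
    using gibbs_diff_le[OF f g, of z] gibbs_diff_le[OF f, of 0 z]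
    by (simp_all add: Q_def gibbs_0)
  have "P f * Q f - P g * Q g = (P f - P g) * Q f + P g * (Q f - Q g)"
    by (simp add: algebra_simps)
  then have "\<bar>P f * Q f - P g * Q g\<bar> \<le> \<bar>P f - P g\<bar> * \<bar>Q f\<bar> + \<bar>P g\<bar> * \<bar>Q f - Q g\<bar>"
    by (metis abs_mult abs_triangle_ineq)
  also have "\<dots> \<le> (3 * norm (f - g)) * (90 * norm f) + (3 * norm g) * (90 * norm (f - g))"
    using P Q by (intro add_mono mult_mono) auto
  finally have PQ: "\<bar>P f * Q f - P g * Q g\<bar> \<le> 270 * (norm f + norm g) * norm (f - g)"
    by (simp add: algebra_simps)
  \<comment> \<open>The constants 3 and 270 of the two estimates add up to less than 600.\<close>
  have "0 \<le> (norm f + norm g) * norm (f - g)" by simp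
  then have "\<bar>gibbs_remainder f z - gibbs_remainder g z\<bar> \<le> 600 * (norm f + norm g) * norm (f - g)"
    unfolding eq using E PQ by linarith
  then show "norm (apply_bcontfun (gibbs_remainder f - gibbs_remainder g) z)
      \<le> 600 * (norm f + norm g) * norm (f - g)"
    by simp
qed

section \<open>From solutions of the exponent equation to stationary densities\<close>

definition gibbs_density :: "((real \<times> real) \<Rightarrow>\<^sub>C real) \<Rightarrow> real \<Rightarrow> real \<Rightarrow> real" where
  "gibbs_density g u x = apply_bcontfun (gibbs g) (u, x) / (2 * pi)"

text \<open>As \<open>\<nu>\<close> is nonzero, \<open>g\<close> lies in the range of
  \<open>T\<close> and inherits the symmetries of the kernel.\<close>

lemma gibbs_even_periodic:
  assumes "T (gibbs g) = \<nu> *\<^sub>R g" "\<nu> \<noteq> 0"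
  shows "apply_bcontfun (gibbs g) (- u, x) = gibbs g (u, x)"
    and "apply_bcontfun (gibbs g) (u + 2 * pi, x) = gibbs g (u, x)"
proof -
  have g: "apply_bcontfun g z = T (gibbs g) z / \<nu>" for z
    using assms by simp
  have "apply_bcontfun g (- u, x) = g (u, x)" "apply_bcontfun g (u + 2 * pi, x) = g (u, x)"
    unfolding g T_even T_periodic by (rule refl)+
  then show "apply_bcontfun (gibbs g) (- u, x) = gibbs g (u, x)"
    "apply_bcontfun (gibbs g) (u + 2 * pi, x) = gibbs g (u, x)"
    by (simp_all only: apply_gibbs partition_fn_fibre[of g "- u" x u] partition_fn_fibre[of g "u + 2 * pi" x u])
qed

lemma gibbs_density_even_densities:
  assumes "T (gibbs g) = \<nu> *\<^sub>R g" "\<nu> \<noteq> 0"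
  shows "gibbs_density g \<in> even_densities"
proof -
  have "(\<lambda>u x. apply_bcontfun ((1 / (2 * pi)) *\<^sub>R gibbs g) (u, x)) \<in> L2_even"
    by (rule bcontfun_L2_even) (simp_all add: gibbs_even_periodic[OF assms])
  then have "gibbs_density g \<in> L2_even"
    by (simp add: gibbs_density_def[abs_def])
  moreover have "0 \<le> gibbs_density g u x" for u x
    using partition_fn_pos[of g "(u, x)"] by (simp add: gibbs_density_def apply_gibbs)
  moreover have "(LBINT u:{0..2 * pi}. gibbs_density g u x) = 1" for x
    by (simp add: gibbs_density_def integral_gibbs)
  ultimately show ?thesis
    by (simp add: even_densities_def)
qed

lemma gibbs_density_stationary:
  assumes g: "T (gibbs g) = \<nu> *\<^sub>R g" "\<nu> \<noteq> 0" and x: "x \<in> {0..1}"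
  shows "gibbs_density g u x = stationary_map W D \<beta> (gibbs_density g) (1 / \<nu>) u x"
proof -
  \<comment> \<open>The contribution of the removed Fourier mode, divided by \<open>\<nu>\<close>.
    It is independent of \<open>u\<close>, so it cancels between the exponential and its
    normalisation.\<close>
  define c where "c = \<beta> / (2 * pi) * D_mean * weighted_mass (gibbs g) x / \<nu>"
  have "- \<beta> * (1 / \<nu>) * mean_field W D (gibbs_density g) w x = g (w, x) - c" for w
  proof -
    have mf: "mean_field W D (\<lambda>v y. gibbs g (v, y)) w x = 2 * pi * mean_field W D (gibbs_density g) w x"
      by (simp add: mean_field_def gibbs_density_def)
    have "\<nu> * g (w, x) = T_op W D \<beta> (\<lambda>v y. gibbs g (v, y)) w x + \<nu> * c"
      using T_eq_T_op[of "gibbs g" x w] gibbs_even_periodic[OF g] x g by (simp add: c_def)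
    then have "\<nu> * g (w, x) = - \<beta> * mean_field W D (gibbs_density g) w x + \<nu> * c"
      by (simp add: T_op_def mf)
    then show ?thesis
      using g(2) by (simp add: field_simps)
  qed
  then have "stationary_map W D \<beta> (gibbs_density g) (1 / \<nu>) u x
      = exp (g (u, x) - c) / (LBINT w:{0..2 * pi}. exp (g (w, x) - c))"
    by (simp only: stationary_map_def)
  also have "\<dots> = exp (g (u, x)) / (LBINT w:{0..2 * pi}. exp (g (w, x)))"
    by (simp add: exp_diff)
  also have "\<dots> = gibbs_density g u x"
    by (simp add: gibbs_density_def apply_gibbs partition_fn_def apply_fibre_mean apply_exp)
  finally show ?thesis by simp
qed

lemma L2_norm_gibbs_density:
  "L2_norm (\<lambda>u x. gibbs_density g u x - 1 / (2 * pi))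
    = sqrt (B (gibbs g - one_bcontfun) (gibbs g - one_bcontfun)) / (2 * pi)"
proof -
  have "(LINT z:strip|lborel. (gibbs_density g (fst z) (snd z) - 1 / (2 * pi))\<^sup>2)
      = (LINT z:strip|lborel. (apply_bcontfun (gibbs g - one_bcontfun) z)\<^sup>2 / (2 * pi)\<^sup>2)"
    by (simp add: gibbs_density_def power_divide flip: diff_divide_distrib)
  also have "\<dots> = B (gibbs g - one_bcontfun) (gibbs g - one_bcontfun) / (2 * pi)\<^sup>2"
    by (simp only: B_self_strip set_integral_divide_zero)
  finally show ?thesis
    by (simp only: L2_norm_def real_sqrt_divide real_sqrt_abs) simp
qed

lemma bifurcation_at_simple_eigenvalue:
  assumes simple: "simple_eigenvalue W D \<beta> \<mu>" and \<mu>: "\<mu> \<noteq> 0"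
    and \<phi>: "\<phi> \<noteq> 0" "T \<phi> = \<mu> *\<^sub>R \<phi>"
  shows "bifurcation_from_uniform W D \<beta> (1 / \<mu>)"
  unfolding bifurcation_from_uniform_def
proof (intro allI impI)
  fix \<epsilon> :: real assume \<epsilon>: "0 < \<epsilon>"
  interpret S: simple_nonzero_eigenvalue T B "kernel_bound\<^sup>2 * measure strip_measure (space strip_measure)" \<mu> \<phi>
    by (rule simple_eigenvalue_locale[OF assms])
  obtain k where k: "0 < k" "\<And>x. norm (T x) \<le> norm x * k"
    using T.pos_bounded by blast
  define m where "m = measure strip_measure (space strip_measure)"
  define c where "c = 90 * sqrt m / (2 * pi)"
  have c: "0 \<le> c" by (simp add: c_def m_def)
  \<comment> \<open>In turn: the remainder estimates need norm at most 1; the L^2 distance must stay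
    below \<open>\<epsilon>\<close>; \<open>\<nu>\<close> must stay away from 0; and the reciprocals
    of \<open>\<nu>\<close> and \<open>\<mu>\<close> must differ by less than
    \<open>\<epsilon>\<close>.\<close>
  define \<delta> where "\<delta> = min (min 1 (\<epsilon> / (c + 1))) (min (\<bar>\<mu>\<bar> / 2) (\<epsilon> * \<mu>\<^sup>2 / 2))"
  have \<delta>: "0 < \<delta>" "\<delta> \<le> 1" "\<delta> \<le> \<epsilon> / (c + 1)"
    using \<epsilon> \<mu> c by (auto simp: \<delta>_def add_nonneg_pos)
  have \<delta>': "\<delta> \<le> \<bar>\<mu>\<bar> / 2" "\<delta> \<le> \<epsilon> * \<mu>\<^sup>2 / 2"
    unfolding \<delta>_def by (rule min.coboundedI2, rule min.cobounded1) (rule min.coboundedI2, rule min.cobounded2)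
  have "norm ((T (gibbs x) - T x) - (T (gibbs y) - T y)) \<le> (600 * k) * (norm x + norm y) * norm (x - y)"
    if "norm x \<le> 1" "norm y \<le> 1" for x y
  proof -
    have "norm (T (gibbs_remainder x - gibbs_remainder y)) \<le> norm (gibbs_remainder x - gibbs_remainder y) * k"
      by (rule k)
    also have "\<dots> \<le> (600 * (norm x + norm y) * norm (x - y)) * k"
      using gibbs_remainder_diff_le[OF that] k(1) by (intro mult_right_mono) auto
    finally show ?thesis
      by (simp add: T.diff T_gibbs_remainder mult_ac)
  qed
  moreover have "T (gibbs 0) = 0"
    by (simp add: gibbs_0 T_one)
  ultimately obtain g \<nu> where g: "g \<noteq> 0" "norm g < \<delta>" "\<bar>\<nu> - \<mu>\<bar> < \<delta>" "T (gibbs g) = \<nu> *\<^sub>R g"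
    using S.bifurcation[of "\<lambda>x. T (gibbs x)" "600 * k" \<delta>] \<delta>(1) by blast
  have \<nu>: "\<bar>\<mu>\<bar> / 2 \<le> \<bar>\<nu>\<bar>" "\<nu> \<noteq> 0"
    using g(3) \<delta>'(1) \<mu> by linarith+
  let ?d = "gibbs g - one_bcontfun"
  have "\<bar>1 / \<nu> - 1 / \<mu>\<bar> = \<bar>\<nu> - \<mu>\<bar> / (\<bar>\<nu>\<bar> * \<bar>\<mu>\<bar>)"
    using \<nu>(2) \<mu> by (simp add: field_simps abs_minus_commute flip: abs_mult abs_divide)
  also have "\<dots> \<le> \<bar>\<nu> - \<mu>\<bar> / (\<bar>\<mu>\<bar> / 2 * \<bar>\<mu>\<bar>)"
    using \<nu> \<mu> by (intro divide_left_mono mult_right_mono mult_pos_pos) auto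
  also have "\<dots> = 2 * \<bar>\<nu> - \<mu>\<bar> / \<mu>\<^sup>2"
    by (simp add: power2_eq_square)
  also have "\<dots> < \<epsilon>"
    using g(3) \<delta>'(2) \<mu> by (simp add: pos_divide_less_eq)
  finally have "\<bar>1 / \<nu> - 1 / \<mu>\<bar> < \<epsilon>" .
  \<comment> \<open>A solution equal to the uniform state as an L^2 class would have the same image
    under \<open>T\<close>, namely 0, which forces \<open>g\<close> to vanish.\<close>
  moreover have "B ?d ?d \<noteq> 0"
  proof
    assume "B ?d ?d = 0"
    then have "T ?d = 0" by (rule T_eq_0)
    then have "\<nu> *\<^sub>R g = 0" by (simp add: T.diff T_one g(4))
    then show False using \<nu>(2) g(1) by simp
  qed
  then have "0 < L2_norm (\<lambda>u x. gibbs_density g u x - 1 / (2 * pi))"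
    using B_nonneg[of ?d] by (simp add: L2_norm_gibbs_density)
  moreover have "L2_norm (\<lambda>u x. gibbs_density g u x - 1 / (2 * pi)) < \<epsilon>"
  proof -
    have n: "norm ?d \<le> 90 * norm g"
      using g(2) \<delta>(2) by (intro norm_gibbs_sub_one_le) simp
    have "B ?d ?d \<le> norm ?d * norm ?d * m"
      using B_bound[of ?d ?d] by (simp add: m_def)
    also have "\<dots> \<le> (90 * norm g) * (90 * norm g) * m"
      using n by (intro mult_right_mono mult_mono) (auto simp: m_def)
    finally have "sqrt (B ?d ?d) \<le> sqrt ((90 * norm g)\<^sup>2 * m)"
      by (intro real_sqrt_le_mono) (simp add: power2_eq_square)
    then have "sqrt (B ?d ?d) / (2 * pi) \<le> c * norm g"
      by (simp add: c_def real_sqrt_mult field_simps)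
    also have "\<dots> \<le> c * \<delta>"
      using g(2) c by (intro mult_left_mono) auto
    also have "\<dots> \<le> c * (\<epsilon> / (c + 1))"
      using \<delta>(3) c by (intro mult_left_mono)
    also have "\<dots> < \<epsilon>"
      using \<epsilon> c by (simp add: field_simps)
    finally show ?thesis
      by (simp add: L2_norm_gibbs_density)
  qed
  ultimately show "\<exists>r\<in>even_densities. \<exists>\<theta>. \<bar>\<theta> - 1 / \<mu>\<bar> < \<epsilon> \<and>
        0 < L2_norm (\<lambda>u x. r u x - 1 / (2 * pi)) \<and> L2_norm (\<lambda>u x. r u x - 1 / (2 * pi)) < \<epsilon> \<and>
        (\<forall>u. \<forall>x\<in>{0..1}. r u x = stationary_map W D \<beta> r \<theta> u x)"
    using gibbs_density_even_densities[OF g(4) \<nu>(2)] gibbs_density_stationary[OF g(4) \<nu>(2)]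
    by (intro bexI[of _ "gibbs_density g"] exI[of _ "1 / \<nu>"]) auto
qed

end

text \<open>The strengths of the model are positive, so the first conjunct minimises over the
  positive values and also yields existence of that minimum. The second conjunct treats the minimum
  over both signs; there existence is a premise, because negative eigenvalues tending to 0 can make
  the set unbounded below.\<close>

theorem proposition3p6:
  fixes W :: "real \<Rightarrow> real \<Rightarrow> real" and D :: "real \<Rightarrow> real" and \<beta> :: real
    and V :: "nat \<Rightarrow> real \<Rightarrow> real" and lam :: "nat \<Rightarrow> real"
  assumes "graphon W"
    and "interaction_potential D"
    and "0 < \<beta>"
    and "graphon_eigenbasis W V lam"
  shows "(critical_strengths W D \<beta> lam \<inter> {0<..} \<noteq> {} \<longrightarrow>
           (\<exists>\<theta>c. is_minimum \<theta>c (critical_strengths W D \<beta> lam \<inter> {0<..}) \<and>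
                  bifurcation_from_uniform W D \<beta> \<theta>c)) \<and>
         (\<forall>\<theta>c. is_minimum \<theta>c (critical_strengths W D \<beta> lam) \<longrightarrow>
                  bifurcation_from_uniform W D \<beta> \<theta>c)"
proof -
  interpret mean_field_model W D \<beta>
    using assms by unfold_locales
  \<comment> \<open>The strengths are exactly reciprocals of simple nonzero eigenvalues, each with a
    continuous eigenfunction, so the bifurcation theorem applies at every one of them.\<close>
  have strength: "\<exists>\<mu> \<phi>. s = 1 / \<mu> \<and> \<mu> \<noteq> 0 \<and> simple_eigenvalue W D \<beta> \<mu> \<and> \<phi> \<noteq> 0 \<and> T \<phi> = \<mu> *\<^sub>R \<phi>"
    if "s \<in> critical_strengths W D \<beta> lam" for s
  proof -
    obtain m l where s: "s = - (2 * pi / (\<beta> * lam l)) * inverse (cos_coeff D m)"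
      and ml: "1 \<le> m" "1 \<le> l" "simple_eigenvalue W D \<beta> (mode_eigenvalue D \<beta> lam m l)"
      and nz: "mode_eigenvalue D \<beta> lam m l \<noteq> 0"
      using \<open>s \<in> critical_strengths W D \<beta> lam\<close> by (auto simp: critical_strengths_def simple_modes_def)
    have "lam l \<noteq> 0"
      using nz by (auto simp: mode_eigenvalue_def)
    then obtain \<phi> where "\<phi> \<noteq> 0" "T \<phi> = mode_eigenvalue D \<beta> lam m l *\<^sub>R \<phi>"
      using mode_eigenfunction[OF assms(4) ml(2,1)] by blast
    moreover have "s = 1 / mode_eigenvalue D \<beta> lam m l"
      by (simp add: s mode_eigenvalue_def divide_simps)
    ultimately show ?thesis
      using ml(3) nz by blast
  qed
  have bif: "bifurcation_from_uniform W D \<beta> s" if "s \<in> critical_strengths W D \<beta> lam" for s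
    using strength[OF that] bifurcation_at_simple_eigenvalue by blast
  have "\<exists>\<theta>c. is_minimum \<theta>c (critical_strengths W D \<beta> lam \<inter> {0<..})"
    if ne: "critical_strengths W D \<beta> lam \<inter> {0<..} \<noteq> {}"
  proof -
    obtain s0 where s0: "s0 \<in> critical_strengths W D \<beta> lam" "0 < s0"
      using ne by auto
    \<comment> \<open>Only strengths up to a given one compete for the minimum. They are reciprocals
      of eigenvalues bounded below by \<open>1 / s0\<close>, of which there are finitely
      many.\<close>
    let ?S = "{s \<in> critical_strengths W D \<beta> lam. 0 < s \<and> s \<le> s0}"
    let ?E = "{\<mu>. 1 / s0 \<le> \<bar>\<mu>\<bar> \<and> (\<exists>\<phi>. \<phi> \<noteq> 0 \<and> T \<phi> = \<mu> *\<^sub>R \<phi>)}"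
    have "finite ?S"
    proof (rule finite_subset)
      show "?S \<subseteq> (\<lambda>\<mu>. 1 / \<mu>) ` ?E"
      proof
        fix s assume s: "s \<in> ?S"
        then obtain \<mu> \<phi> where \<mu>: "s = 1 / \<mu>" "\<mu> \<noteq> 0" "\<phi> \<noteq> 0" "T \<phi> = \<mu> *\<^sub>R \<phi>"
          using strength[of s] by blast
        have "0 < \<mu>" "1 / \<mu> \<le> s0"
          using s \<mu> by auto
        then have "1 / s0 \<le> \<bar>\<mu>\<bar>"
          using s0(2) by (simp add: field_simps)
        then show "s \<in> (\<lambda>\<mu>. 1 / \<mu>) ` ?E"
          using \<mu> by blast
      qed
      show "finite ((\<lambda>\<mu>. 1 / \<mu>) ` ?E)"
        using s0(2) by (intro finite_imageI finite_eigenvalues_away_from_0) simp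
    qed
    moreover have "s0 \<in> ?S"
      using s0 by simp
    ultimately have M: "Min ?S \<in> ?S" "\<And>s. s \<in> ?S \<Longrightarrow> Min ?S \<le> s"
      using Min_in[of ?S] Min_le[of ?S] by blast+
    have "is_minimum (Min ?S) (critical_strengths W D \<beta> lam \<inter> {0<..})"
      unfolding is_minimum_def
    proof (intro conjI ballI)
      show "Min ?S \<in> critical_strengths W D \<beta> lam \<inter> {0<..}"
        using M(1) by auto
      fix s assume s: "s \<in> critical_strengths W D \<beta> lam \<inter> {0<..}"
      show "Min ?S \<le> s"
      proof (cases "s \<le> s0")
        case True
        then show ?thesis using s M(2)[of s] by auto
      next
        case False
        then show ?thesis using M(1) by auto
      qed
    qed
    then show ?thesis ..
  qed
  then show ?thesis
    using bif by (auto simp: is_minimum_def)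
qed

end
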